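(* Let $(X_i)_{i\ge1}$ be i.i.d. $h$-lattice valued random variables with $\mathbf{E}X_i=0$, $\mathbf{E}X_i^2=\sigma^2>0$ (with $\sigma>0$) and $\mathbf{E}|X_i|^3<\infty$, and let $S_n=\sum_{i=1}^nX_i$. Let $(n_i)_{i\ge1}$ be an increasing sequence of positive integers and let $a\in\mathbb{R}$. (a) If $\sum_{i=1}^\infty n_i^{-1/2}<\infty$, then $\mathbf{P}(S_{n_i}=a\sqrt{n_i}\ \text{for infinitely many } i)=0$. (b) Suppose there exist $A>0$ and $\gamma>1$ such that \[ n_{i+1}-n_i\ge A\,n_i^{1/2}\quad\text{for all } i\ge 1, \] and \[ n_i\le A^{-1}\,i^2(\log i)(\log\log i)^{-3}(\log\log\log i)^{-2\gamma} \] for all $i$ such that $\log\log\log i>0$. Then \[ \frac{\sum_{i=1}^n 1_{\{S_{n_i}=a\sigma\sqrt{n_i}\}}}{\sum_{i=1}^n n_i^{-1/2}}\to\frac{h}{\sqrt{2\pi}\,\sigma}\,e^{-a^2/2}\quad\text{almost surely as } n\to\infty. \] Moreover, if $A>0$ and $\gamma>1$ are such that $n_{i+1}-n_i\ge A\,n_i^{1/2}$ for all $i\ge 1$ and $n_i\le A^{-1}\,i^2(\log i)(\log\log i)^{-3}(\log\log\log i)^{-2\gamma}$ for all $i$ such that $\log\log\log i>0$, then, for $a\in\mathbb{R}$, let \[ \Delta_n^a=\left(\frac{\sum_{i=1}^n 1_{\{S_{n_i}=a\sigma\sqrt{n_i}\}}}{\sum_{i=1}^n n_i^{-1/2}}\right)\Big/\left(\frac{h}{\sqrt{2\pi}\,\sigma}\,e^{-a^2/2}\right).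 \] Then for every $N>0$ there exists $C>0$ such that, for every $\epsilon>0$ and every $n$ with $\log\log\log n>0$, \[ \sup_{a\in[-N,N]}\mathbf{P}\left(|\Delta_n^a-1|>\epsilon\right)\le C\,\epsilon^{-2}(\log\log n)^{-1}(\log\log\log n)^{-\gamma}. \]
   Context: A random variable $X$ is $h$-lattice valued if $\sum_{k\in\mathbb{Z}}\mathbf{P}(X=kh+b)=1$ for some $h>0$ and $b\in\mathbb{R}$; here $h$ is assumed to be maximal with this property, and $b$ is fixed accordingly. Convention (abuse of notation): for $c\in\mathbb{R}$, the event "$S_n=c\sqrt n$" means $S_n=\left[(c\sqrt n-nb)/h\right]h+nb$, where $[\cdot]$ denotes the integer part; this applies with $c=a$ in (a) and with $c=a\sigma$ in (b). $1_E$ is the indicator function of the event $E$. *)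

theory Defs
  imports "HOL-Probability.Probability"
begin

definition lattice_with :: "'a measure \<Rightarrow> ('a \<Rightarrow> real) \<Rightarrow> real \<Rightarrow> real \<Rightarrow> bool" where
  "lattice_with M X h b \<longleftrightarrow>
     h > 0 \<and> ((\<lambda>k::int. measure M {\<omega> \<in> space M. X \<omega> = of_int k * h + b}) has_sum 1) UNIV"

definition lattice_valued :: "'a measure \<Rightarrow> ('a \<Rightarrow> real) \<Rightarrow> real \<Rightarrow> real \<Rightarrow> bool" where
  "lattice_valued M X h b \<longleftrightarrow>
     lattice_with M X h b \<and> (\<forall>h' b'. lattice_with M X h' b' \<longrightarrow> h' \<le> h)"

text \<open>All sequences below are indexed from 1; their value at 0 is irrelevant.\<close>

definition iid :: "'a measure \<Rightarrow> (nat \<Rightarrow> 'a \<Rightarrow> real) \<Rightarrow> bool" where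
  "iid M X \<longleftrightarrow>
     prob_space.indep_vars M (\<lambda>_. borel) X {1..} \<and>
     (\<forall>i\<ge>1. distr M borel (X i) = distr M borel (X 1))"

definition partial_sum :: "(nat \<Rightarrow> 'a \<Rightarrow> real) \<Rightarrow> nat \<Rightarrow> 'a \<Rightarrow> real" where
  "partial_sum X n \<omega> = (\<Sum>i=1..n. X i \<omega>)"

definition lattice_round :: "real \<Rightarrow> real \<Rightarrow> real \<Rightarrow> nat \<Rightarrow> real" where
  "lattice_round h b c n =
     of_int \<lfloor>(c * sqrt (real n) - real n * b) / h\<rfloor> * h + real n * b"

text \<open>The event conventionally written \<open>S\<^sub>n = c \<surd>n\<close>.\<close>

definition hit_event ::
  "'a measure \<Rightarrow> (nat \<Rightarrow> 'a \<Rightarrow> real) \<Rightarrow> real \<Rightarrow> real \<Rightarrow> real \<Rightarrow> nat \<Rightarrow> 'a set" where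
  "hit_event M X h b c n = {\<omega> \<in> space M. partial_sum X n \<omega> = lattice_round h b c n}"

definition hit_ratio ::
  "'a measure \<Rightarrow> (nat \<Rightarrow> 'a \<Rightarrow> real) \<Rightarrow> real \<Rightarrow> real \<Rightarrow> (nat \<Rightarrow> nat) \<Rightarrow> real \<Rightarrow> nat \<Rightarrow> 'a \<Rightarrow> real" where
  "hit_ratio M X h b ns c m \<omega> =
     (\<Sum>i=1..m. indicator (hit_event M X h b c (ns i)) \<omega>) /
     (\<Sum>i=1..m. real (ns i) powr (-1/2))"

definition limit_density :: "real \<Rightarrow> real \<Rightarrow> real \<Rightarrow> real" where
  "limit_density h \<sigma> a = h / (sqrt (2 * pi) * \<sigma>) * exp (- a\<^sup>2 / 2)"

definition \<Delta> ::
  "'a measure \<Rightarrow> (nat \<Rightarrow> 'a \<Rightarrow> real) \<Rightarrow> real \<Rightarrow> real \<Rightarrow> real \<Rightarrow> (nat \<Rightarrow> nat) \<Rightarrow> real \<Rightarrow> nat \<Rightarrow> 'a \<Rightarrow> real" where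
  "\<Delta> M X h b \<sigma> ns a m \<omega> = hit_ratio M X h b ns (a * \<sigma>) m \<omega> / limit_density h \<sigma> a"

text \<open>
  The library logarithm is total, with \<open>ln 0 = 0\<close> and \<open>ln (- x) = ln x\<close>. On natural numbers
  this does not enlarge the range on which the triple logarithm is positive.
\<close>

lemma logloglog_pos_iff:
  fixes i :: nat
  shows "ln (ln (ln (real i))) > 0 \<longleftrightarrow> real i > exp (exp 1)"
proof
  assume "real i > exp (exp 1)"
  then have "ln (real i) > exp 1"
    by (metis exp_gt_zero ln_exp ln_less_cancel_iff order_less_trans)
  then have "ln (ln (real i)) > 1"
    by (metis exp_gt_zero ln_exp ln_less_cancel_iff order_less_trans)
  then show "ln (ln (ln (real i))) > 0"
    by simp
next
  assume pos: "ln (ln (ln (real i))) > 0"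
  consider "i = 0" | "i = 1" | "i = 2" | "i \<ge> 3"
    by linarith
  then show "real i > exp (exp 1)"
  proof cases
    case 3
    have l: "ln (2::real) \<ge> 2/3"
      by (rule ln2_ge_two_thirds)
    have l1: "ln (2::real) < 1"
      by (rule ln_2_less_1)
    have "exp (-1::real) \<le> 1/2"
      using exp_ge_add_one_self[of "1::real"] by (simp add: exp_minus field_simps)
    then have "exp (-1::real) \<le> ln 2"
      using l by linarith
    then have "- 1 \<le> ln (ln (2::real))"
      using l by (subst ln_ge_iff) auto
    moreover have "ln (ln (2::real)) < 0"
      using l l1 by simp
    ultimately have "ln (- ln (ln (2::real))) \<le> 0"
      by simp
    then show ?thesis
      using pos 3 by (simp add: ln_minus)
  next
    case 4
    have "exp 1 < real i"
      using 4 e_less_272 by linarith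
    then have l: "ln (real i) > 1"
      by (metis exp_gt_zero ln_exp ln_less_cancel_iff order_less_trans)
    then have l2: "ln (ln (real i)) > 0"
      by simp
    then have "ln (ln (real i)) > 1"
      using pos by simp
    then have "ln (real i) > exp 1"
      using l by (metis exp_less_mono exp_ln less_trans zero_less_one)
    then show ?thesis
      using 4 by (metis exp_less_mono exp_ln gr0I not_numeral_le_zero of_nat_0_less_iff)
  qed (use pos in auto)
qed

definition growth_cond :: "real \<Rightarrow> real \<Rightarrow> (nat \<Rightarrow> nat) \<Rightarrow> bool" where
  "growth_cond A \<gamma> ns \<longleftrightarrow>
     (\<forall>i\<ge>1. real (ns (i + 1)) - real (ns i) \<ge> A * real (ns i) powr (1/2)) \<and>
     (\<forall>i\<ge>1. ln (ln (ln (real i))) > 0 \<longrightarrow>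
        real (ns i) \<le> inverse A * (real i)\<^sup>2 * ln (real i) * ln (ln (real i)) powr (-3)
                       * ln (ln (ln (real i))) powr (-2 * \<gamma>))"

end

theory Submission
  imports Defs "HOL-Real_Asymp.Real_Asymp"
begin

text \<open>
  Let \<open>p\<^sub>i\<close> be the probability of a hit at time \<open>n\<^sub>i\<close>. Fourier inversion gives the local limit theorem
  with error \<open>O(1/n)\<close>: near \<open>0\<close> the third moment controls \<open>\<phi>(t) - exp(-\<sigma>\<^sup>2t\<^sup>2/2)\<close>, and maximality of
  \<open>h\<close> keeps \<open>\<bar>\<phi>\<bar>\<close> away from \<open>1\<close> on the rest of \<open>[-\<pi>/h, \<pi>/h]\<close>. So \<open>p\<^sub>i = L n\<^sub>i\<^sup>-\<^sup>1\<^sup>/\<^sup>2 + O(1/n\<^sub>i)\<close>, where \<open>L\<close> is the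
  limit density, and (a) is the Borel--Cantelli lemma.

  For (b), write \<open>r\<close> and \<open>s\<close> for the square roots of \<open>n\<^sub>i\<close> and \<open>n\<^sub>j\<close>, \<open>i < j\<close>, and \<open>m = n\<^sub>j - n\<^sub>i\<close>. Independence of increments and
  the local limit theorem bound \<open>E(Z\<^sub>i Z\<^sub>j)\<close>, where \<open>Z\<^sub>i = 1\<^sub>h\<^sub>i\<^sub>t - L/r\<close>, by a multiple of \<open>1/(s \<surd>m) + 1/(r m)\<close>.
  The gap condition makes \<open>r\<close> grow at least linearly in \<open>i\<close>, so that \<open>m \<ge> \<kappa> (j - i) s\<close>, and the sum of
  these bounds over \<open>i < j\<close> is \<open>O(1/s)\<close>. Hence the second moment of the sum of the \<open>Z\<^sub>i\<close> is \<open>O(B\<^sub>n)\<close>, where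
  \<open>B\<^sub>n\<close> is the sum of the \<open>n\<^sub>i\<^sup>-\<^sup>1\<^sup>/\<^sup>2\<close>, \<open>i \<le> n\<close>. Chebyshev's inequality bounds the deviation
  probability by \<open>O(\<epsilon>\<^sup>-\<^sup>2 / B\<^sub>n)\<close>, and the upper bound on \<open>n\<^sub>i\<close> makes \<open>B\<^sub>n\<close> at least of order
  \<open>(log n)\<^sup>1\<^sup>/\<^sup>2\<close>, which is more than is needed. Almost sure convergence follows along times where
  \<open>B\<^sub>n\<close> is about \<open>k\<^sup>2\<close>, and monotonicity fills the gaps.
\<close>

section \<open>Characteristic functions of lattice variables\<close>

text \<open>As \<open>h > 0\<close>, distinct \<open>k\<close> give disjoint events, so by countable
  additivity the series is the probability of their union. The enumeration \<open>int_decode\<close>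
  moves additivity along \<open>nat\<close> to a \<open>has_sum\<close> over
  \<open>int\<close>.\<close>

lemma (in prob_space) lattice_with_iff_AE:
  assumes [measurable]: "X \<in> borel_measurable M"
  shows "lattice_with M X h b \<longleftrightarrow> h > 0 \<and> (AE \<omega> in M. \<exists>k::int. X \<omega> = of_int k * h + b)"
proof (cases "h > 0")
  case True
  define A where "A k = {\<omega> \<in> space M. X \<omega> = of_int k * h + b}" for k :: int
  have [measurable]: "A k \<in> sets M" for k
    unfolding A_def by measurable
  have "disjoint_family (\<lambda>n. A (int_decode n))"
    using True by (auto simp: disjoint_family_on_def A_def dest: injD[OF inj_int_decode])
  then have "(\<lambda>n. prob (A (int_decode n))) sums prob (\<Union>n. A (int_decode n))"
    by (intro finite_measure_UNION) auto
  then have "((\<lambda>n. prob (A (int_decode n))) has_sum prob (\<Union>n. A (int_decode n))) UNIV"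
    by (intro sums_nonneg_imp_has_sum) auto
  then have "((\<lambda>k. prob (A k)) has_sum prob (\<Union>n. A (int_decode n))) UNIV"
    by (subst (asm) has_sum_reindex_bij_betw[OF bij_int_decode])
  moreover have "(\<Union>n. A (int_decode n)) = {\<omega> \<in> space M. \<exists>k::int. X \<omega> = of_int k * h + b}"
    using surj_int_decode unfolding A_def by (auto 0 4)
  ultimately have *: "((\<lambda>k. prob (A k)) has_sum
      prob {\<omega> \<in> space M. \<exists>k::int. X \<omega> = of_int k * h + b}) UNIV"
    by simp
  then have "((\<lambda>k. prob (A k)) has_sum 1) UNIV \<longleftrightarrow>
      prob {\<omega> \<in> space M. \<exists>k::int. X \<omega> = of_int k * h + b} = 1"
    by (auto dest: has_sum_unique)
  also have "\<dots> \<longleftrightarrow> (AE \<omega> in M. \<exists>k::int. X \<omega> = of_int k * h + b)"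
    by (subst prob_Collect_eq_1) auto
  finally show ?thesis
    using True by (simp add: lattice_with_def A_def)
qed (simp add: lattice_with_def)

text \<open>If the modulus were 1, the unit-modulus variable
  \<open>cnj z * iexp (t * X \<omega>)\<close> would have mean 1 and hence equal 1 almost surely.
  That puts \<open>X\<close> on a lattice of span \<open>2 * pi / \<bar>t\<bar>\<close>, which
  exceeds \<open>h\<close> and contradicts maximality.\<close>

lemma (in prob_space) norm_char_less_1:
  assumes [measurable]: "X \<in> borel_measurable M"
    and lat: "lattice_valued M X h b" and t: "t \<noteq> 0" "\<bar>t\<bar> * h < 2 * pi"
  shows "cmod (char (distr M borel X) t) < 1"
proof (rule ccontr)
  interpret D: real_distribution "distr M borel X"
    by simp
  define z where "z = char (distr M borel X) t"
  assume "\<not> cmod (char (distr M borel X) t) < 1"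
  with D.cmod_char_le_1[of t] have z1: "cmod z = 1"
    by (simp add: z_def)
  have z_eq: "z = expectation (\<lambda>\<omega>. iexp (t * X \<omega>))"
    unfolding z_def char_def by (subst integral_distr) auto
  have int: "integrable M (\<lambda>\<omega>. iexp (t * X \<omega>))"
    by (rule integrable_const_bound[of _ 1]) auto
  have "expectation (\<lambda>\<omega>. cnj z * iexp (t * X \<omega>)) = cnj z * z"
    using int by (simp add: z_eq del: of_real_mult)
  also have "\<dots> = 1"
    using z1 by (simp add: complex_norm_square[symmetric] mult.commute)
  finally have "Re (expectation (\<lambda>\<omega>. cnj z * iexp (t * X \<omega>))) = 1"
    by simp
  moreover have intc: "integrable M (\<lambda>\<omega>. cnj z * iexp (t * X \<omega>))"
    using int by (rule integrable_mult_right)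
  ultimately have E1: "expectation (\<lambda>\<omega>. Re (cnj z * iexp (t * X \<omega>))) = 1"
    by (subst integral_Re) auto
  have norm1: "cmod (cnj z * iexp (t * X \<omega>)) = 1" for \<omega>
    using z1 by (simp add: norm_mult del: of_real_mult)
  have intR: "integrable M (\<lambda>\<omega>. Re (cnj z * iexp (t * X \<omega>)))"
    using intc by (rule integrable_Re)
  \<comment> \<open>A nonnegative variable with mean 0 vanishes almost surely. Real part 1 and
    modulus 1 then force the complex number itself to be 1.\<close>
  have "AE \<omega> in M. 1 - Re (cnj z * iexp (t * X \<omega>)) = 0"
  proof (subst integral_nonneg_eq_0_iff_AE[symmetric])
    show "integrable M (\<lambda>\<omega>. 1 - Re (cnj z * iexp (t * X \<omega>)))"
      using intR by auto
    show "AE \<omega> in M. 0 \<le> 1 - Re (cnj z * iexp (t * X \<omega>))"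
      using complex_Re_le_cmod norm1 by (metis AE_I2 diff_ge_0_iff_ge)
    show "expectation (\<lambda>\<omega>. 1 - Re (cnj z * iexp (t * X \<omega>))) = 0"
      by (subst Bochner_Integration.integral_diff) (use intR E1 in \<open>auto simp: prob_space\<close>)
  qed
  then have *: "AE \<omega> in M. iexp (t * X \<omega>) = z"
  proof eventually_elim
    case (elim \<omega>)
    let ?u = "cnj z * iexp (t * X \<omega>)"
    have "Re ?u = 1" using elim by simp
    moreover have "(cmod ?u)\<^sup>2 = 1" using norm1[of \<omega>] by simp
    ultimately have "Im ?u = 0" unfolding cmod_power2 by simp
    with \<open>Re ?u = 1\<close> have "?u = 1" by (auto simp: complex_eq_iff)
    then have "z * ?u = z" by simp
    moreover have "z * cnj z = 1"
      using z1 by (simp add: complex_norm_square[symmetric])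
    ultimately show ?case
      by (metis mult.assoc mult_1)
  qed
  have zA: "z = iexp (Arg z)"
    using Arg_eq[of z] z1 by (cases "z = 0") auto
  define h' where "h' = 2 * pi / \<bar>t\<bar>"
  have h': "h' > 0"
    using t by (simp add: h'_def)
  have "AE \<omega> in M. \<exists>k::int. X \<omega> = of_int k * h' + Arg z / t"
    using *
  proof eventually_elim
    case (elim \<omega>)
    then have "exp (\<i> * complex_of_real (t * X \<omega>)) = exp (\<i> * complex_of_real (Arg z))"
      using zA by simp
    then obtain n :: int where
      "\<i> * complex_of_real (t * X \<omega>) = \<i> * complex_of_real (Arg z) + (of_int (2 * n) * pi) * \<i>"
      unfolding exp_eq by blast
    then have "Im (\<i> * complex_of_real (t * X \<omega>)) =
        Im (\<i> * complex_of_real (Arg z) + (of_int (2 * n) * pi) * \<i>)"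
      by (rule arg_cong)
    then have n: "t * X \<omega> = Arg z + 2 * n * pi"
      by simp
    \<comment> \<open>The span is built from \<open>\<bar>t\<bar>\<close>, so a negative
      \<open>t\<close> flips the sign of the lattice index.\<close>
    then have "X \<omega> = of_int (if t > 0 then n else - n) * h' + Arg z / t"
      using t(1) by (auto simp: h'_def field_simps)
    then show ?case by blast
  qed
  with h' have "lattice_with M X h' (Arg z / t)"
    by (simp add: lattice_with_iff_AE)
  then have "h' \<le> h"
    using lat unfolding lattice_valued_def by blast
  then show False
    using t by (simp add: h'_def field_simps)
qed

lemma abs_pow3: "\<bar>t :: real\<bar> ^ 3 = \<bar>t\<bar> * t\<^sup>2"
proof -
  have "\<bar>t\<bar> ^ 3 = \<bar>t\<bar> * \<bar>t\<bar>\<^sup>2"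
    by (simp only: power3_eq_cube power2_eq_square mult.assoc)
  then show ?thesis by simp
qed

section \<open>Expansion of the characteristic function at 0 and Gaussian domination\<close>

lemma (in prob_space) char_approx_third_moment:
  assumes [measurable]: "X \<in> borel_measurable M"
    and int3: "integrable M (\<lambda>\<omega>. \<bar>X \<omega>\<bar> ^ 3)" and mean: "expectation X = 0"
    and var: "expectation (\<lambda>\<omega>. (X \<omega>)\<^sup>2) = \<sigma>\<^sup>2"
  shows "cmod (char (distr M borel X) t - (1 - t\<^sup>2 * \<sigma>\<^sup>2 / 2)) \<le> expectation (\<lambda>\<omega>. \<bar>X \<omega>\<bar> ^ 3) / 6 * \<bar>t\<bar> ^ 3"
proof -
  \<comment> \<open>The third absolute moment dominates the lower powers, which yields their
    integrability.\<close>
  have pow: "\<bar>x\<bar> \<le> 1 + \<bar>x\<bar> ^ 3" "x\<^sup>2 \<le> 1 + \<bar>x\<bar> ^ 3" for x :: real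
  proof -
    have "\<bar>x\<bar> \<le> 1 + \<bar>x\<bar> ^ 3 \<and> \<bar>x\<bar>\<^sup>2 \<le> 1 + \<bar>x\<bar> ^ 3"
    proof (cases "\<bar>x\<bar> \<le> 1")
      case True
      then show ?thesis using power_le_one[of "\<bar>x\<bar>" 2] zero_le_power[of "\<bar>x\<bar>" 3] by linarith
    next
      case False
      then show ?thesis
        using power_increasing[of 1 3 "\<bar>x\<bar>"] power_increasing[of 2 3 "\<bar>x\<bar>"] by simp
    qed
    then show "\<bar>x\<bar> \<le> 1 + \<bar>x\<bar> ^ 3" "x\<^sup>2 \<le> 1 + \<bar>x\<bar> ^ 3" by auto
  qed
  have bound: "integrable M (\<lambda>\<omega>. 1 + \<bar>X \<omega>\<bar> ^ 3)"
    using int3 by simp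
  have i1: "integrable M X"
    by (rule Bochner_Integration.integrable_bound[OF bound]) (use pow in \<open>auto intro: order_trans\<close>)
  have i2: "integrable M (\<lambda>\<omega>. (X \<omega>)\<^sup>2)"
    by (rule Bochner_Integration.integrable_bound[OF bound]) (use pow in \<open>auto intro: order_trans\<close>)
  have "cmod (char (distr M borel X) t - (1 - t\<^sup>2 * \<sigma>\<^sup>2 / 2)) \<le>
      (t\<^sup>2 / 6) * expectation (\<lambda>\<omega>. min (6 * (X \<omega>)\<^sup>2) (\<bar>t\<bar> * \<bar>X \<omega>\<bar> ^ 3))"
    by (rule char_approx3'[OF _ i1 i2 mean _ refl]) (use mean var in auto)
  \<comment> \<open>Choosing the second entry of the minimum turns the Taylor remainder into a cubic
    error.\<close>
  also have "\<dots> \<le> (t\<^sup>2 / 6) * expectation (\<lambda>\<omega>. \<bar>t\<bar> * \<bar>X \<omega>\<bar> ^ 3)"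
    using int3 i2 by (intro mult_left_mono integral_mono) (auto intro!: integrable_min)
  also have "\<dots> = expectation (\<lambda>\<omega>. \<bar>X \<omega>\<bar> ^ 3) / 6 * \<bar>t\<bar> ^ 3"
    using int3 by (simp add: abs_pow3 mult_ac)
  finally show ?thesis .
qed

text \<open>Both functions agree with \<open>1 - \<sigma>\<^sup>2 * t\<^sup>2 / 2\<close> up to a
  cubic error. For the Gaussian the error is of fourth order; the bound
  \<open>\<bar>t\<bar> \<le> T\<close> trades one power of \<open>\<bar>t\<bar>\<close> for a
  constant.\<close>

lemma (in prob_space) char_approx_gauss:
  assumes [measurable]: "X \<in> borel_measurable M"
    and int3: "integrable M (\<lambda>\<omega>. \<bar>X \<omega>\<bar> ^ 3)" and mean: "expectation X = 0"
    and var: "expectation (\<lambda>\<omega>. (X \<omega>)\<^sup>2) = \<sigma>\<^sup>2"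
  obtains C where "C > 0"
    "\<And>t. \<bar>t\<bar> \<le> T \<Longrightarrow> cmod (char (distr M borel X) t - exp (- \<sigma>\<^sup>2 * t\<^sup>2 / 2)) \<le> C * \<bar>t\<bar> ^ 3"
proof -
  define \<beta> where "\<beta> = expectation (\<lambda>\<omega>. \<bar>X \<omega>\<bar> ^ 3) / 6"
  \<comment> \<open>The summand 1 makes \<open>C\<close> positive, and \<open>\<bar>T\<bar>\<close>
    keeps the last summand nonnegative for every \<open>T\<close>.\<close>
  define C where "C = 1 + \<beta> + \<sigma> ^ 4 * \<bar>T\<bar> / 8"
  have "\<beta> \<ge> 0" unfolding \<beta>_def by auto
  then have C: "C > 0" unfolding C_def
    by (metis abs_ge_zero add_nonneg_nonneg add_pos_nonneg divide_nonneg_nonneg mult_nonneg_nonneg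
        zero_le_even_power even_numeral zero_le_numeral zero_less_one)
  moreover have "cmod (char (distr M borel X) t - exp (- \<sigma>\<^sup>2 * t\<^sup>2 / 2)) \<le> C * \<bar>t\<bar> ^ 3"
    if t: "\<bar>t\<bar> \<le> T" for t
  proof -
    define u where "u = \<sigma>\<^sup>2 * t\<^sup>2 / 2"
    have u: "u \<ge> 0" by (simp add: u_def)
    have l: "1 - u \<le> exp (- u)" using exp_ge_add_one_self[of "-u"] by simp
    \<comment> \<open>The reciprocal of the Taylor lower bound for \<open>exp u\<close> is at most
      \<open>1 - u + u\<^sup>2 / 2\<close>, because the product of the two quadratics is
      \<open>1 + u ^ 4 / 4\<close>.\<close>
    have "exp (- u) \<le> 1 / (1 + u + u\<^sup>2 / 2)"
      using exp_lower_Taylor_quadratic[OF u] u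
      by (simp add: exp_minus inverse_eq_divide field_simps add_pos_nonneg)
    also have "\<dots> \<le> 1 - u + u\<^sup>2 / 2"
    proof -
      have "(1 - u + u\<^sup>2 / 2) * (1 + u + u\<^sup>2 / 2) = 1 + u ^ 4 / 4"
        by (simp add: field_simps power2_eq_square power4_eq_xxxx)
      moreover have "1 + u + u\<^sup>2 / 2 > 0" using u by (simp add: add_pos_nonneg)
      ultimately show ?thesis
        by (simp add: pos_divide_le_eq)
    qed
    finally have "\<bar>exp (- u) - (1 - u)\<bar> \<le> u\<^sup>2 / 2" using l by simp
    also have "u\<^sup>2 / 2 = \<sigma> ^ 4 / 8 * \<bar>t\<bar> ^ 3 * \<bar>t\<bar>"
      by (simp add: u_def abs_pow3 power2_eq_square power4_eq_xxxx)
    also have "\<dots> \<le> \<sigma> ^ 4 / 8 * \<bar>t\<bar> ^ 3 * \<bar>T\<bar>"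
      using t by (intro mult_left_mono) auto
    finally have 1: "\<bar>exp (- u) - (1 - u)\<bar> \<le> \<sigma> ^ 4 * \<bar>T\<bar> / 8 * \<bar>t\<bar> ^ 3" by (simp add: mult_ac)
    have 2: "cmod (char (distr M borel X) t - (1 - t\<^sup>2 * \<sigma>\<^sup>2 / 2)) \<le> \<beta> * \<bar>t\<bar> ^ 3"
      unfolding \<beta>_def using assms by (rule char_approx_third_moment)
    have "cmod (char (distr M borel X) t - exp (- u)) \<le>
        cmod (char (distr M borel X) t - (1 - t\<^sup>2 * \<sigma>\<^sup>2 / 2)) + cmod (of_real ((1 - u) - exp (- u)))"
      by (rule order_trans[OF _ norm_triangle_ineq]) (simp add: u_def algebra_simps flip: exp_of_real)
    also have "\<dots> \<le> \<beta> * \<bar>t\<bar> ^ 3 + \<sigma> ^ 4 * \<bar>T\<bar> / 8 * \<bar>t\<bar> ^ 3"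
      using 1 2 by (intro add_mono) (simp_all only: norm_of_real abs_minus_commute)
    also have "\<dots> \<le> C * \<bar>t\<bar> ^ 3"
      unfolding C_def by (simp add: algebra_simps)
    finally show ?thesis by (simp add: u_def)
  qed
  ultimately show ?thesis using that by blast
qed

text \<open>Near 0 the quadratic term of the expansion beats the cubic error. On the rest of the
  interval, compactness and \<open>norm_char_less_1\<close> keep the modulus below some
  \<open>\<rho> < 1\<close>. The condition \<open>c \<le> \<sigma>\<^sup>2 / 2\<close> lets the
  limiting Gaussian obey the same bound.\<close>

lemma (in prob_space) norm_char_le_gauss:
  assumes [measurable]: "X \<in> borel_measurable M"
    and lat: "lattice_valued M X h b"
    and int3: "integrable M (\<lambda>\<omega>. \<bar>X \<omega>\<bar> ^ 3)" and mean: "expectation X = 0"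
    and var: "expectation (\<lambda>\<omega>. (X \<omega>)\<^sup>2) = \<sigma>\<^sup>2" and \<sigma>: "\<sigma> > 0"
  obtains c where "c > 0" "c \<le> \<sigma>\<^sup>2 / 2"
    "\<And>t. \<bar>t\<bar> \<le> pi / h \<Longrightarrow> cmod (char (distr M borel X) t) \<le> exp (- c * t\<^sup>2)"
proof -
  interpret D: real_distribution "distr M borel X"
    by simp
  define \<phi> where "\<phi> = char (distr M borel X)"
  define \<beta> where "\<beta> = expectation (\<lambda>\<omega>. \<bar>X \<omega>\<bar> ^ 3) / 6"
  have "\<beta> \<ge> 0" unfolding \<beta>_def by auto
  have h: "h > 0" using lat by (auto simp: lattice_valued_def lattice_with_def)
  \<comment> \<open>The first entry gives \<open>t\<^sup>2 * \<sigma>\<^sup>2 \<le> 1\<close>, so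
    that \<open>1 - t\<^sup>2 * \<sigma>\<^sup>2 / 2\<close> is nonnegative. The second makes the
    cubic error at most half of the quadratic term; \<open>\<beta> + 1\<close> keeps the denominator
    positive.\<close>
  define \<delta> where "\<delta> = min (1 / \<sigma>) (\<sigma>\<^sup>2 / (4 * (\<beta> + 1)))"
  have \<delta>: "\<delta> > 0" using \<sigma> \<open>\<beta> \<ge> 0\<close> by (simp add: \<delta>_def)
  have near: "cmod (\<phi> t) \<le> exp (- (\<sigma>\<^sup>2 / 4) * t\<^sup>2)" if t: "\<bar>t\<bar> \<le> \<delta>" for t
  proof -
    have "\<bar>t\<bar> * \<sigma> \<le> 1" using t \<sigma> by (simp add: \<delta>_def field_simps)
    then have "(\<bar>t\<bar> * \<sigma>)\<^sup>2 \<le> 1" using \<sigma> by (simp add: power_le_one)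
    then have le1: "t\<^sup>2 * \<sigma>\<^sup>2 \<le> 1" by (simp add: power_mult_distrib)
    have "\<beta> * \<bar>t\<bar> \<le> (\<beta> + 1) * \<delta>" using t \<open>\<beta> \<ge> 0\<close> by (intro mult_mono) auto
    also have "\<dots> \<le> (\<beta> + 1) * (\<sigma>\<^sup>2 / (4 * (\<beta> + 1)))"
      using \<open>\<beta> \<ge> 0\<close> by (intro mult_left_mono) (auto simp: \<delta>_def)
    also have "\<dots> = \<sigma>\<^sup>2 / 4" using \<open>\<beta> \<ge> 0\<close> by (simp add: divide_simps)
    finally have "\<beta> * \<bar>t\<bar> * t\<^sup>2 \<le> \<sigma>\<^sup>2 / 4 * t\<^sup>2" by (intro mult_right_mono) auto
    then have b3: "\<beta> * \<bar>t\<bar> ^ 3 \<le> \<sigma>\<^sup>2 / 4 * t\<^sup>2"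
      by (simp add: abs_pow3 mult.assoc)
    have "cmod (\<phi> t) \<le> cmod (\<phi> t - (1 - t\<^sup>2 * \<sigma>\<^sup>2 / 2)) + cmod (of_real (1 - t\<^sup>2 * \<sigma>\<^sup>2 / 2))"
      by (rule order_trans[OF _ norm_triangle_ineq]) simp
    also have "\<dots> \<le> \<beta> * \<bar>t\<bar> ^ 3 + (1 - t\<^sup>2 * \<sigma>\<^sup>2 / 2)"
      using char_approx_third_moment[OF assms(1) int3 mean var, of t] le1
      by (intro add_mono) (simp_all add: \<phi>_def \<beta>_def norm_of_real del: of_real_diff)
    also have "\<dots> \<le> 1 - \<sigma>\<^sup>2 / 4 * t\<^sup>2" using b3 by (simp add: field_simps)
    also have "\<dots> \<le> exp (- (\<sigma>\<^sup>2 / 4) * t\<^sup>2)"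
      using exp_ge_add_one_self[of "- (\<sigma>\<^sup>2 / 4) * t\<^sup>2"] by simp
    finally show ?thesis .
  qed
  define K where "K = {t. \<delta> \<le> \<bar>t\<bar> \<and> \<bar>t\<bar> \<le> pi / h}"
  \<comment> \<open>The set \<open>K\<close> is empty when \<open>\<delta>\<close> exceeds
    \<open>pi / h\<close>. Otherwise the maximum over \<open>K\<close> is attained and is below 1;
    taking \<open>max\<close> with 1/2 ensures \<open>\<rho> > 0\<close>, so that
    \<open>ln \<rho>\<close> is meaningful.\<close>
  have "\<exists>\<rho>. 0 < \<rho> \<and> \<rho> < 1 \<and> (\<forall>t\<in>K. cmod (\<phi> t) \<le> \<rho>)"
  proof (cases "K = {}")
    case True
    then show ?thesis by (intro exI[of _ "1/2"]) auto
  next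
    case False
    have "closed K" unfolding K_def by (intro closed_Collect_conj closed_Collect_le continuous_intros)
    moreover have "bounded K" unfolding K_def bounded_iff by auto
    ultimately have "compact K" by (simp add: compact_eq_bounded_closed)
    moreover have "continuous_on K (\<lambda>t. cmod (\<phi> t))"
      unfolding \<phi>_def
      by (intro continuous_on_norm continuous_at_imp_continuous_on ballI D.isCont_char)
    ultimately obtain t0 where t0: "t0 \<in> K" "\<forall>t\<in>K. cmod (\<phi> t) \<le> cmod (\<phi> t0)"
      using continuous_attains_sup[of K] False by blast
    have "\<bar>t0\<bar> * h \<le> pi" using t0(1) h by (simp add: K_def field_simps)
    then have "\<bar>t0\<bar> * h < 2 * pi" using pi_gt_zero by linarith
    moreover have "t0 \<noteq> 0" using t0(1) \<delta> by (auto simp: K_def)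
    ultimately have "cmod (\<phi> t0) < 1"
      unfolding \<phi>_def using lat by (intro norm_char_less_1[OF assms(1)])
    then show ?thesis using t0(2)
      by (intro exI[of _ "max (1/2) (cmod (\<phi> t0))"]) (auto simp: le_max_iff_disj)
  qed
  then obtain \<rho> where \<rho>: "0 < \<rho>" "\<rho> < 1" "\<And>t. t \<in> K \<Longrightarrow> cmod (\<phi> t) \<le> \<rho>" by blast
  \<comment> \<open>The second entry is chosen so that \<open>exp (- c * t\<^sup>2)\<close> is still
    at least \<open>\<rho>\<close> at the endpoints \<open>\<bar>t\<bar> = pi / h\<close>.\<close>
  define c where "c = min (\<sigma>\<^sup>2 / 4) (- ln \<rho> * h\<^sup>2 / pi\<^sup>2)"
  have "c > 0" using \<rho> \<sigma> h by (auto simp: c_def intro!: divide_neg_pos mult_neg_pos)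
  moreover have c4: "c \<le> \<sigma>\<^sup>2 / 4" unfolding c_def by (rule min.cobounded1)
  then have "c \<le> \<sigma>\<^sup>2 / 2" using zero_le_power2[of \<sigma>] by linarith
  moreover have "cmod (\<phi> t) \<le> exp (- c * t\<^sup>2)" if t: "\<bar>t\<bar> \<le> pi / h" for t
  proof (cases "\<bar>t\<bar> \<le> \<delta>")
    case True
    have "c * t\<^sup>2 \<le> \<sigma>\<^sup>2 / 4 * t\<^sup>2" using c4 by (intro mult_right_mono) auto
    then show ?thesis using near[OF True] by (rule_tac order_trans) auto
  next
    case False
    then have "cmod (\<phi> t) \<le> \<rho>" using t by (intro \<rho>) (auto simp: K_def)
    also have "\<rho> = exp (ln \<rho>)" using \<rho> by simp
    also have "\<dots> \<le> exp (- c * t\<^sup>2)"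
    proof -
      have "\<bar>t\<bar>\<^sup>2 \<le> (pi / h)\<^sup>2" using t by (intro power_mono) auto
      then have "c * t\<^sup>2 \<le> (- ln \<rho> * h\<^sup>2 / pi\<^sup>2) * (pi / h)\<^sup>2"
        using \<open>c > 0\<close> by (intro mult_mono) (auto simp: c_def)
      also have "\<dots> = - ln \<rho>" using h by (simp add: field_simps)
      finally show ?thesis by simp
    qed
    finally show ?thesis .
  qed
  ultimately show ?thesis using that unfolding \<phi>_def by blast
qed

section \<open>The local limit theorem\<close>

text \<open>Orthogonality of exponentials over a full period: for \<open>k \<noteq> 0\<close> the
  antiderivative takes equal values at the endpoints, whose phases differ by
  \<open>2 * pi * k\<close>.\<close>

lemma integral_iexp_lattice:
  fixes k :: int
  assumes h: "h > 0"
  shows "(CLINT t|lborel. indicator {- (pi / h)..pi / h} t *\<^sub>R iexp (t * (of_int k * h))) =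
    (if k = 0 then of_real (2 * pi / h) else 0)"
proof (cases "k = 0")
  case True
  then show ?thesis
    using h by (simp add: scaleR_conv_of_real)
next
  case False
  define F where "F t = iexp (t * (of_int k * h)) / (\<i> * of_real (of_int k * h))" for t :: real
  have "(CLINT t|lborel. indicator {- (pi / h)..pi / h} t *\<^sub>R iexp (t * (of_int k * h))) =
      F (pi / h) - F (- (pi / h))"
  proof (rule integral_FTC_atLeastAtMost)
    show "- (pi / h) \<le> pi / h" using h by (simp add: minus_le_iff)
    show "(F has_vector_derivative iexp (t * (of_int k * h))) (at t within {- (pi / h)..pi / h})" for t
    proof -
      have d: "((\<lambda>t. t * (of_int k * h)) has_vector_derivative of_int k * h) (at t within {- (pi / h)..pi / h})"
        by (auto intro!: derivative_eq_intros)
      have "((\<lambda>t. iexp (t * (of_int k * h))) has_vector_derivative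
          (of_int k * h) *\<^sub>R (\<i> * iexp (t * (of_int k * h)))) (at t within {- (pi / h)..pi / h})"
        using vector_diff_chain_within[OF d has_vector_derivative_iexp] by (simp add: o_def)
      from has_vector_derivative_divide[OF this, of "\<i> * of_real (of_int k * h)"]
      show ?thesis
        using False h by (simp add: F_def[abs_def] scaleR_conv_of_real field_simps)
    qed
    show "continuous_on {- (pi / h)..pi / h} (\<lambda>t. iexp (t * (of_int k * h)))"
      by (intro continuous_intros)
  qed
  also have "iexp (pi / h * (of_int k * h)) = iexp (- (pi / h) * (of_int k * h))"
    unfolding exp_eq using h by (intro exI[of _ k]) (simp add: field_simps)
  then have "F (pi / h) - F (- (pi / h)) = 0"
    by (simp add: F_def)
  finally show ?thesis
    using False by simp
qed

text \<open>Fubini, valid for a bounded integrand on a set of finite measure, moves the integral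
  over \<open>t\<close> inside the expectation. By orthogonality only the outcomes with
  \<open>Y \<omega> = x\<close> survive. Taking \<open>x\<close> as base point of the lattice
  absorbs the shift.\<close>

lemma (in prob_space) lattice_fourier_inversion:
  assumes [measurable]: "Y \<in> borel_measurable M" and h: "h > 0"
    and lat: "AE \<omega> in M. \<exists>k::int. Y \<omega> = of_int k * h + x"
  shows "complex_of_real (2 * pi / h * prob {\<omega> \<in> space M. Y \<omega> = x}) =
    (CLINT t|lborel. indicator {- (pi / h)..pi / h} t *\<^sub>R (iexp (- (t * x)) * char (distr M borel Y) t))"
proof -
  interpret P: pair_sigma_finite lborel M ..
  let ?J = "{- (pi / h)..pi / h}"
  have "(CLINT t|lborel. indicator ?J t *\<^sub>R (iexp (- (t * x)) * char (distr M borel Y) t)) =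
      (CLINT t|lborel. (CLINT \<omega>|M. indicator ?J t *\<^sub>R iexp (t * (Y \<omega> - x))))"
  proof (intro Bochner_Integration.integral_cong refl)
    fix t
    have "char (distr M borel Y) t = (CLINT \<omega>|M. iexp (t * Y \<omega>))"
      unfolding char_def by (subst integral_distr) auto
    then have "iexp (- (t * x)) * char (distr M borel Y) t = (CLINT \<omega>|M. iexp (- (t * x)) * iexp (t * Y \<omega>))"
      by (simp del: of_real_mult of_real_minus)
    also have "\<dots> = (CLINT \<omega>|M. iexp (t * (Y \<omega> - x)))"
      by (simp add: algebra_simps flip: exp_add)
    finally show "indicator ?J t *\<^sub>R (iexp (- (t * x)) * char (distr M borel Y) t) =
        (CLINT \<omega>|M. indicator ?J t *\<^sub>R iexp (t * (Y \<omega> - x)))"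
      by (simp del: of_real_mult of_real_minus of_real_diff)
  qed
  also have "\<dots> = (CLINT \<omega>|M. (CLINT t|lborel. indicator ?J t *\<^sub>R iexp (t * (Y \<omega> - x))))"
  proof (intro P.Fubini_integral [symmetric] integrableI_bounded_set [where B=1 and A="?J \<times> space M"])
    show "emeasure (lborel \<Otimes>\<^sub>M M) (?J \<times> space M) < \<infinity>"
      using h by (subst emeasure_pair_measure_Times)
        (auto simp: ennreal_mult_less_top not_less top_unique emeasure_space_1)
    show "AE z\<in>?J \<times> space M in lborel \<Otimes>\<^sub>M M.
        norm (case z of (t, \<omega>) \<Rightarrow> indicat_real ?J t *\<^sub>R iexp (t * (Y \<omega> - x))) \<le> 1"
      by (intro AE_I2) (auto split: split_indicator)
  qed (auto simp: space_pair_measure split: split_indicator split_indicator_asm intro!: AE_I2)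
  also have "\<dots> = (CLINT \<omega>|M. of_real (2 * pi / h * indicator {\<omega> \<in> space M. Y \<omega> = x} \<omega>))"
  proof (intro integral_cong_AE)
    show "AE \<omega> in M. (CLINT t|lborel. indicator ?J t *\<^sub>R iexp (t * (Y \<omega> - x))) =
        complex_of_real (2 * pi / h * indicator {\<omega> \<in> space M. Y \<omega> = x} \<omega>)"
      using lat AE_space
    proof eventually_elim
      case (elim \<omega>)
      then obtain k :: int where k: "Y \<omega> = of_int k * h + x" by blast
      have "(CLINT t|lborel. indicator ?J t *\<^sub>R iexp (t * (Y \<omega> - x))) =
          (if k = 0 then of_real (2 * pi / h) else 0)"
        using integral_iexp_lattice[OF h, of k] k by simp
      then show ?case
        using k h elim by (auto simp: indicator_def)
    qed
  qed auto
  also have "\<dots> = complex_of_real (2 * pi / h * prob {\<omega> \<in> space M. Y \<omega> = x})"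
    by (subst integral_complex_of_real) simp
  finally show ?thesis by simp
qed

section \<open>Gaussian integrals and the comparison of powers\<close>

lemma gaussian_fourier:
  assumes v: "v > 0"
  shows "(CLINT t|lborel. iexp (- (t * x)) * of_real (exp (- v * t\<^sup>2 / 2))) =
    of_real (sqrt (2 * pi / v) * exp (- x\<^sup>2 / (2 * v)))"
proof -
  \<comment> \<open>After the substitution \<open>t = y / sqrt v\<close>, the integral is the
    standard normal characteristic function at the frequency \<open>s\<close>.\<close>
  define s where "s = - x / sqrt v"
  have "complex_of_real (exp (- s\<^sup>2 / 2)) = (CLINT y|std_normal_distribution. iexp (s * y))"
    using char_std_normal_distribution unfolding char_def fun_eq_iff by (simp only:)
  also have "\<dots> = (CLINT y|lborel. std_normal_density y *\<^sub>R iexp (s * y))"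
    by (subst integral_density) auto
  finally have *: "(CLINT y|lborel. std_normal_density y *\<^sub>R iexp (s * y)) =
      complex_of_real (exp (- s\<^sup>2 / 2))" by simp
  have "(CLINT t|lborel. iexp (- (t * x)) * of_real (exp (- v * t\<^sup>2 / 2))) =
      \<bar>1 / sqrt v\<bar> *\<^sub>R (CLINT y|lborel. iexp (- ((0 + 1 / sqrt v * y) * x)) *
        of_real (exp (- v * (0 + 1 / sqrt v * y)\<^sup>2 / 2)))"
    using v by (intro lborel_integral_real_affine) auto
  also have "\<dots> = (1 / sqrt v) *\<^sub>R (CLINT y|lborel. sqrt (2 * pi) *\<^sub>R (std_normal_density y *\<^sub>R iexp (s * y)))"
    using v by (intro arg_cong2[where f="(*\<^sub>R)"] Bochner_Integration.integral_cong)
      (auto simp: s_def std_normal_density_def power_divide scaleR_conv_of_real mult_ac)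
  also have "\<dots> = of_real (sqrt (2 * pi / v) * exp (- s\<^sup>2 / 2))"
    by (subst integral_scaleR_right, subst *) (simp_all add: scaleR_conv_of_real real_sqrt_divide)
  also have "s\<^sup>2 = x\<^sup>2 / v"
    using v by (simp add: s_def power_divide)
  finally show ?thesis by (simp add: mult.commute)
qed

text \<open>This is the third absolute moment of a centred normal law with variance
  \<open>\<tau>\<^sup>2 = 1 / (2 * a)\<close>, freed of its normalising constant. It supplies the
  rate in the local limit theorem.\<close>

lemma gaussian_third_moment:
  assumes a: "a > (0::real)"
  shows "has_bochner_integral lborel (\<lambda>t. \<bar>t\<bar> ^ 3 * exp (- a * t\<^sup>2)) (1 / a\<^sup>2)"
proof -
  define \<tau> where "\<tau> = 1 / sqrt (2 * a)"
  have \<tau>: "\<tau> > 0" "\<tau>\<^sup>2 = 1 / (2 * a)"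
    using a by (auto simp: \<tau>_def power_divide)
  have "has_bochner_integral lborel (\<lambda>x. sqrt (2 * pi * \<tau>\<^sup>2) * (normal_density 0 \<tau> x * \<bar>x - 0\<bar> ^ (2 * 1 + 1)))
      (sqrt (2 * pi * \<tau>\<^sup>2) * (2 ^ 1 * \<tau> ^ (2 * 1 + 1) * fact 1 * sqrt (2 / pi)))"
    using \<tau>(1) by (intro has_bochner_integral_mult_right normal_moment_abs_odd)
  also have "(\<lambda>x. sqrt (2 * pi * \<tau>\<^sup>2) * (normal_density 0 \<tau> x * \<bar>x - 0\<bar> ^ (2 * 1 + 1))) =
      (\<lambda>t. \<bar>t\<bar> ^ 3 * exp (- a * t\<^sup>2))"
  proof
    fix x
    have "x\<^sup>2 / (2 * \<tau>\<^sup>2) = a * x\<^sup>2"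
      using a by (simp add: \<tau>(2))
    then show "sqrt (2 * pi * \<tau>\<^sup>2) * (normal_density 0 \<tau> x * \<bar>x - 0\<bar> ^ (2 * 1 + 1)) = \<bar>x\<bar> ^ 3 * exp (- a * x\<^sup>2)"
      using \<tau>(1) by (simp add: normal_density_def numeral_3_eq_3)
  qed
  also have "sqrt (2 * pi * \<tau>\<^sup>2) * (2 ^ 1 * \<tau> ^ (2 * 1 + 1) * fact 1 * sqrt (2 / pi)) = 4 * (\<tau>\<^sup>2)\<^sup>2"
    using \<tau>(1) by (simp add: real_sqrt_mult real_sqrt_divide power2_eq_square power3_eq_cube)
  also have "\<dots> = 1 / a\<^sup>2"
    by (simp add: \<tau>(2) power_divide power_mult_distrib)
  finally show ?thesis .
qed

text \<open>Telescoping: peeling off one factor writes the next difference as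
  \<open>z * (z ^ Suc n - w ^ Suc n) + (z - w) * w ^ Suc n\<close>. Each term retains
  \<open>n\<close> factors bounded by \<open>B\<close>.\<close>

lemma norm_power_diff_le:
  fixes z w :: "'a :: {real_normed_algebra_1, comm_ring_1}"
  assumes "norm z \<le> B" "norm w \<le> B"
  shows "norm (z ^ Suc n - w ^ Suc n) \<le> real (Suc n) * B ^ n * norm (z - w)"
proof (induction n)
  case (Suc n)
  have B: "B \<ge> 0" using assms norm_ge_zero order_trans by blast
  have "norm (z ^ Suc (Suc n) - w ^ Suc (Suc n)) = norm (z * (z ^ Suc n - w ^ Suc n) + (z - w) * w ^ Suc n)"
    by (simp add: algebra_simps)
  also have "\<dots> \<le> norm z * norm (z ^ Suc n - w ^ Suc n) + norm (z - w) * norm (w ^ Suc n)"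
    by (intro order_trans[OF norm_triangle_ineq] add_mono norm_mult_ineq)
  also have "\<dots> \<le> B * (real (Suc n) * B ^ n * norm (z - w)) + norm (z - w) * B ^ Suc n"
    using assms B Suc.IH
    by (intro add_mono mult_mono order_trans[OF norm_power_ineq] power_mono) auto
  also have "\<dots> = real (Suc (Suc n)) * B ^ Suc n * norm (z - w)"
    by (simp add: algebra_simps)
  finally show ?case .
qed simp

text \<open>The inversion integral over the compact interval is compared with the Gaussian integral
  over the whole line. The difference of the integrands is at most \<open>m * K\<close> times a
  cubic-Gaussian function, whose integral is of order \<open>1 / m\<^sup>2\<close>; this leaves an
  error of order \<open>1 / m\<close>.\<close>

lemma (in prob_space) lattice_local_limit:
  fixes \<phi> :: "real \<Rightarrow> complex"
  assumes [measurable]: "Y \<in> borel_measurable M" and h: "h > 0" and \<sigma>: "\<sigma> > 0" and m: "m > 0"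
    and lat: "AE \<omega> in M. \<exists>k::int. Y \<omega> = of_int k * h + x"
    and char: "\<And>t. char (distr M borel Y) t = \<phi> t ^ m"
    and approx: "\<And>t. \<bar>t\<bar> \<le> pi / h \<Longrightarrow> cmod (\<phi> t - exp (- \<sigma>\<^sup>2 * t\<^sup>2 / 2)) \<le> C * \<bar>t\<bar> ^ 3"
    and decay: "\<And>t. \<bar>t\<bar> \<le> pi / h \<Longrightarrow> cmod (\<phi> t) \<le> exp (- c * t\<^sup>2)"
    and c: "0 < c" "c \<le> \<sigma>\<^sup>2 / 2" and C: "0 \<le> C"
  shows "\<bar>prob {\<omega> \<in> space M. Y \<omega> = x} - h / (sqrt (2 * pi) * \<sigma>) / sqrt m * exp (- (x / (\<sigma> * sqrt m))\<^sup>2 / 2)\<bar>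
    \<le> h / (2 * pi) * (C * exp (c * (pi / h)\<^sup>2) + (h / pi) ^ 3) / c\<^sup>2 / m"
proof -
  interpret D: real_distribution "distr M borel Y"
    by simp
  let ?J = "{- (pi / h)..pi / h}"
  \<comment> \<open>The first summand serves the interval \<open>?J\<close>, the second the Gaussian
    tail outside it.\<close>
  define K where "K = C * exp (c * (pi / h)\<^sup>2) + (h / pi) ^ 3"
  have K: "K \<ge> 0" using C h by (simp add: K_def)
  define v where "v = m * \<sigma>\<^sup>2"
  have v: "v > 0" using m \<sigma> by (simp add: v_def)
  define f where "f t = indicator ?J t *\<^sub>R (iexp (- (t * x)) * char (distr M borel Y) t)" for t
  define g where "g t = iexp (- (t * x)) * complex_of_real (exp (- v * t\<^sup>2 / 2))" for t
  have int_f: "integrable lborel f"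
  proof (rule integrableI_bounded_set[where A="?J" and B=1])
    show "f \<in> borel_measurable lborel" unfolding f_def by measurable
    show "AE t\<in>?J in lborel. norm (f t) \<le> 1"
      using D.cmod_char_le_1 by (intro AE_I2) (auto simp: f_def norm_mult simp del: of_real_mult of_real_minus)
  qed (use h in \<open>auto simp: f_def\<close>)
  have int_g: "integrable lborel g"
  proof (rule Bochner_Integration.integrable_bound)
    show "integrable lborel (\<lambda>t. sqrt (2 * pi / v) * normal_density 0 (1 / sqrt v) t)"
      using v by (intro integrable_mult_right integrable_normal_density) auto
    show "g \<in> borel_measurable lborel" unfolding g_def by measurable
    show "AE t in lborel. norm (g t) \<le> norm (sqrt (2 * pi / v) * normal_density 0 (1 / sqrt v) t)"
      using v by (intro AE_I2)
        (auto simp: g_def normal_density_def norm_mult power_divide field_simps simp del: of_real_mult of_real_minus)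
  qed
  have bound: "norm (f t - g t) \<le> m * K * (\<bar>t\<bar> ^ 3 * exp (- (m * c) * t\<^sup>2))" for t
  proof (cases "t \<in> ?J")
    case True
    then have t: "\<bar>t\<bar> \<le> pi / h" by auto
    define w where "w = complex_of_real (exp (- \<sigma>\<^sup>2 * t\<^sup>2 / 2))"
    obtain n where n: "m = Suc n" using m by (cases m) auto
    have ct: "c * t\<^sup>2 \<le> \<sigma>\<^sup>2 / 2 * t\<^sup>2" using c by (intro mult_right_mono) auto
    have wm: "w ^ m = complex_of_real (exp (- v * t\<^sup>2 / 2))"
      by (simp add: w_def v_def mult_ac flip: exp_of_real exp_of_nat_mult of_real_power)
    have "norm (f t - g t) = norm (iexp (- (t * x)) * (\<phi> t ^ m - w ^ m))"
      using True by (simp add: f_def g_def char wm algebra_simps)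
    also have "\<dots> = norm (\<phi> t ^ m - w ^ m)"
      by (simp add: norm_mult del: of_real_mult of_real_minus)
    also have "\<dots> \<le> real m * exp (- c * t\<^sup>2) ^ n * norm (\<phi> t - w)"
      unfolding n using decay[OF t] ct by (intro norm_power_diff_le) (auto simp: w_def)
    \<comment> \<open>Telescoping leaves only \<open>m - 1\<close> decaying factors. Restoring the
      missing one costs \<open>exp (c * t\<^sup>2)\<close>, which is bounded on the
      interval.\<close>
    also have "\<dots> \<le> real m * (exp (- (m * c) * t\<^sup>2) * exp (c * (pi / h)\<^sup>2)) * (C * \<bar>t\<bar> ^ 3)"
    proof (intro mult_mono)
      have "exp (- c * t\<^sup>2) ^ n = exp (- (m * c) * t\<^sup>2) * exp (c * t\<^sup>2)"
        by (simp add: n algebra_simps flip: exp_of_nat_mult exp_add)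
      also have "c * t\<^sup>2 \<le> c * (pi / h)\<^sup>2"
        using c power_mono[OF t, of 2] by (intro mult_left_mono) auto
      then have "exp (- (m * c) * t\<^sup>2) * exp (c * t\<^sup>2) \<le> exp (- (m * c) * t\<^sup>2) * exp (c * (pi / h)\<^sup>2)"
        by simp
      finally show "exp (- c * t\<^sup>2) ^ n \<le> exp (- (m * c) * t\<^sup>2) * exp (c * (pi / h)\<^sup>2)" .
      show "norm (\<phi> t - w) \<le> C * \<bar>t\<bar> ^ 3"
        using approx[OF t] by (simp add: w_def)
    qed auto
    also have "\<dots> = m * (C * exp (c * (pi / h)\<^sup>2)) * (\<bar>t\<bar> ^ 3 * exp (- (m * c) * t\<^sup>2))"
      by (simp add: mult_ac)
    also have "\<dots> \<le> m * K * (\<bar>t\<bar> ^ 3 * exp (- (m * c) * t\<^sup>2))"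
      using h by (intro mult_right_mono mult_left_mono) (auto simp: K_def)
    finally show ?thesis .
  next
    case False
    then have t: "\<bar>t\<bar> > pi / h" by auto
    have ct: "m * (c * t\<^sup>2) \<le> m * (\<sigma>\<^sup>2 / 2 * t\<^sup>2)" using c by (intro mult_left_mono mult_right_mono) auto
    \<comment> \<open>Outside the interval only the Gaussian remains. Inserting a cube that is at
      least 1 gives its tail the same form as the bound inside.\<close>
    have "1 \<le> h / pi * \<bar>t\<bar>" using t h by (simp add: field_simps)
    then have "1 \<le> (h / pi * \<bar>t\<bar>) ^ 3" by (rule one_le_power)
    then have one: "1 \<le> (h / pi) ^ 3 * \<bar>t\<bar> ^ 3" by (simp only: power_mult_distrib)
    have "norm (f t - g t) = exp (- v * t\<^sup>2 / 2)"
      using False by (simp add: f_def g_def norm_mult del: of_real_mult of_real_minus)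
    also have "\<dots> \<le> 1 * 1 * exp (- (m * c) * t\<^sup>2)"
      using ct by (simp add: v_def algebra_simps)
    also have "\<dots> \<le> real m * ((h / pi) ^ 3 * \<bar>t\<bar> ^ 3) * exp (- (m * c) * t\<^sup>2)"
      using m one by (intro mult_right_mono mult_mono) auto
    also have "\<dots> = m * (h / pi) ^ 3 * (\<bar>t\<bar> ^ 3 * exp (- (m * c) * t\<^sup>2))"
      by (simp add: mult_ac)
    also have "\<dots> \<le> m * K * (\<bar>t\<bar> ^ 3 * exp (- (m * c) * t\<^sup>2))"
      using h C by (intro mult_right_mono mult_left_mono) (auto simp: K_def)
    finally show ?thesis .
  qed
  have moment: "has_bochner_integral lborel (\<lambda>t. m * K * (\<bar>t\<bar> ^ 3 * exp (- (m * c) * t\<^sup>2))) (m * K * (1 / (m * c)\<^sup>2))"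
    using m c by (intro has_bochner_integral_mult_right gaussian_third_moment) auto
  have "norm (integral\<^sup>L lborel f - integral\<^sup>L lborel g) = norm (CLINT t|lborel. f t - g t)"
    using int_f int_g by simp
  also have "\<dots> \<le> (\<integral>t. m * K * (\<bar>t\<bar> ^ 3 * exp (- (m * c) * t\<^sup>2)) \<partial>lborel)"
    using moment int_f int_g bound
    by (intro order_trans[OF integral_norm_bound] integral_mono) (auto simp: has_bochner_integral_iff)
  also have "\<dots> = K / c\<^sup>2 / m"
    using moment m by (simp add: has_bochner_integral_iff power2_eq_square field_simps)
  finally have *: "norm (integral\<^sup>L lborel f - integral\<^sup>L lborel g) \<le> K / c\<^sup>2 / m" .
  have "integral\<^sup>L lborel f = of_real (2 * pi / h * prob {\<omega> \<in> space M. Y \<omega> = x})"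
    unfolding f_def by (subst lattice_fourier_inversion[OF _ h lat]) auto
  moreover have "integral\<^sup>L lborel g = of_real (sqrt (2 * pi / v) * exp (- x\<^sup>2 / (2 * v)))"
    unfolding g_def by (rule gaussian_fourier[OF v])
  ultimately have "\<bar>2 * pi / h * prob {\<omega> \<in> space M. Y \<omega> = x} - sqrt (2 * pi / v) * exp (- x\<^sup>2 / (2 * v))\<bar> \<le> K / c\<^sup>2 / m"
    using * by (simp only: norm_of_real flip: of_real_diff)
  then have "h / (2 * pi) * \<bar>2 * pi / h * prob {\<omega> \<in> space M. Y \<omega> = x} - sqrt (2 * pi / v) * exp (- x\<^sup>2 / (2 * v))\<bar>
      \<le> h / (2 * pi) * (K / c\<^sup>2 / m)"
    using h by (intro mult_left_mono) auto
  moreover have "h / (2 * pi) * \<bar>2 * pi / h * prob {\<omega> \<in> space M. Y \<omega> = x} - sqrt (2 * pi / v) * exp (- x\<^sup>2 / (2 * v))\<bar>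
      = \<bar>h / (2 * pi) * (2 * pi / h * prob {\<omega> \<in> space M. Y \<omega> = x} - sqrt (2 * pi / v) * exp (- x\<^sup>2 / (2 * v)))\<bar>"
    using h by (simp add: abs_mult)
  moreover have "h / (2 * pi) * (2 * pi / h * prob {\<omega> \<in> space M. Y \<omega> = x} - sqrt (2 * pi / v) * exp (- x\<^sup>2 / (2 * v)))
      = prob {\<omega> \<in> space M. Y \<omega> = x} - h / (sqrt (2 * pi) * \<sigma>) / sqrt m * exp (- (x / (\<sigma> * sqrt m))\<^sup>2 / 2)"
  proof -
    have e1: "sqrt (2 * pi / v) = sqrt (2 * pi) / (sqrt m * \<sigma>)"
      using \<sigma> by (simp add: v_def real_sqrt_divide real_sqrt_mult)
    have e2: "h / (2 * pi) * (sqrt (2 * pi) / (sqrt m * \<sigma>)) = h / (sqrt (2 * pi) * \<sigma>) / sqrt m"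
    proof -
      define q where "q = sqrt (2 * pi)"
      have q: "q > 0" "2 * pi = q * q" by (simp_all add: q_def)
      show ?thesis
        unfolding q_def[symmetric] q(2) using q(1) by (simp add: divide_simps)
    qed
    have e3: "- x\<^sup>2 / (2 * v) = - (x / (\<sigma> * sqrt m))\<^sup>2 / 2"
      by (simp add: v_def power_divide power_mult_distrib mult_ac)
    have "h / (2 * pi) * (2 * pi / h * prob {\<omega> \<in> space M. Y \<omega> = x} - sqrt (2 * pi / v) * exp (- x\<^sup>2 / (2 * v)))
      = prob {\<omega> \<in> space M. Y \<omega> = x} - h / (2 * pi) * sqrt (2 * pi / v) * exp (- x\<^sup>2 / (2 * v))"
      using h by (simp add: right_diff_distrib)
    then show ?thesis
      by (simp only: e1 e2 e3)
  qed
  ultimately show ?thesis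
    by (simp only: K_def) (simp add: mult_ac)
qed

section \<open>The random walk\<close>

text \<open>The derivative is bounded by 1, since \<open>\<bar>z\<bar> \<le> 1 + z\<^sup>2 / 2 \<le>
  exp (z\<^sup>2 / 2)\<close>. The estimate controls the effect of rounding to the lattice.\<close>

lemma gauss_lipschitz:
  fixes u v :: real
  shows "\<bar>exp (- u\<^sup>2 / 2) - exp (- v\<^sup>2 / 2)\<bar> \<le> \<bar>u - v\<bar>"
proof -
  have "norm (exp (- u\<^sup>2 / 2) - exp (- v\<^sup>2 / 2)) \<le> 1 * norm (u - v)"
  proof (rule field_differentiable_bound[where S=UNIV and f="\<lambda>u. exp (- u\<^sup>2 / 2)" and f'="\<lambda>u. - u * exp (- u\<^sup>2 / 2)"])
    fix z :: real
    show "((\<lambda>u. exp (- u\<^sup>2 / 2)) has_field_derivative - z * exp (- z\<^sup>2 / 2)) (at z within UNIV)"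
      by (auto intro!: derivative_eq_intros)
    have "2 * \<bar>z\<bar> \<le> 1 + \<bar>z\<bar>\<^sup>2"
      using zero_le_power2[of "\<bar>z\<bar> - 1"] by (simp add: power2_eq_square algebra_simps)
    then have "\<bar>z\<bar> \<le> 1 + z\<^sup>2 / 2"
      by simp
    also have "\<dots> \<le> exp (z\<^sup>2 / 2)" by (rule exp_ge_add_one_self)
    finally show "norm (- z * exp (- z\<^sup>2 / 2)) \<le> 1"
      by (simp add: abs_mult exp_minus field_simps)
  qed auto
  then show ?thesis by simp
qed

lemma abs_lattice_round_diff_le:
  assumes "h > 0"
  shows "\<bar>lattice_round h b c n - c * sqrt (real n)\<bar> \<le> h"
proof -
  define y where "y = (c * sqrt (real n) - real n * b) / h"
  have "of_int \<lfloor>y\<rfloor> * h \<le> y * h" "y * h \<le> (of_int \<lfloor>y\<rfloor> + 1) * h"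
    using assms by (intro mult_right_mono; linarith)+
  moreover have "y * h = c * sqrt (real n) - real n * b"
    using assms by (simp add: y_def)
  ultimately show ?thesis
    unfolding lattice_round_def y_def[symmetric] by (simp add: algebra_simps abs_le_iff)
qed

locale lattice_walk = prob_space M for M :: "'a measure" +
  fixes X :: "nat \<Rightarrow> 'a \<Rightarrow> real" and h b \<sigma> :: real
  assumes iid: "iid M X"
    and lattice: "\<And>i. i \<ge> 1 \<Longrightarrow> lattice_valued M (X i) h b"
    and third_moment: "\<And>i. i \<ge> 1 \<Longrightarrow> integrable M (\<lambda>\<omega>. \<bar>X i \<omega>\<bar> ^ 3)"
    and mean: "\<And>i. i \<ge> 1 \<Longrightarrow> expectation (X i) = 0"
    and second_moment: "\<And>i. i \<ge> 1 \<Longrightarrow> expectation (\<lambda>\<omega>. (X i \<omega>)\<^sup>2) = \<sigma>\<^sup>2"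
    and \<sigma>: "\<sigma> > 0"
begin

lemma indep: "indep_vars (\<lambda>_. borel) X {1..}"
  using iid by (simp add: iid_def)

lemma h: "h > 0"
  using lattice[of 1] by (simp add: lattice_valued_def lattice_with_def)

lemma borel_measurable_X: "i \<ge> 1 \<Longrightarrow> X i \<in> borel_measurable M"
  using indep by (auto simp: indep_vars_def)

lemma borel_measurable_block: "I \<subseteq> {1..} \<Longrightarrow> (\<lambda>\<omega>. \<Sum>i\<in>I. X i \<omega>) \<in> borel_measurable M"
  by (intro borel_measurable_sum borel_measurable_X) auto

lemma AE_block_lattice:
  assumes "finite I" "I \<subseteq> {1..}"
  shows "AE \<omega> in M. \<exists>k::int. (\<Sum>i\<in>I. X i \<omega>) = of_int k * h + real (card I) * b"
proof -
  have "AE \<omega> in M. \<forall>i\<in>I. \<exists>k::int. X i \<omega> = of_int k * h + b"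
  proof (intro AE_finite_allI assms)
    fix i assume "i \<in> I"
    then have i: "i \<ge> 1" using assms by auto
    then show "AE \<omega> in M. \<exists>k::int. X i \<omega> = of_int k * h + b"
      using lattice[OF i] lattice_with_iff_AE[OF borel_measurable_X[OF i]]
      by (simp add: lattice_valued_def)
  qed
  then show ?thesis
  proof eventually_elim
    case (elim \<omega>)
    then obtain k :: "nat \<Rightarrow> int" where "\<And>i. i \<in> I \<Longrightarrow> X i \<omega> = of_int (k i) * h + b"
      by metis
    then have "(\<Sum>i\<in>I. X i \<omega>) = of_int (\<Sum>i\<in>I. k i) * h + real (card I) * b"
      by (simp add: sum.distrib sum_distrib_right)
    then show ?case by blast
  qed
qed

lemma local_limit:
  obtains K where "K > 0"
    "\<And>I k x. finite I \<Longrightarrow> I \<subseteq> {1..} \<Longrightarrow> I \<noteq> {} \<Longrightarrow> x = of_int k * h + real (card I) * b \<Longrightarrow>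
      \<bar>prob {\<omega> \<in> space M. (\<Sum>i\<in>I. X i \<omega>) = x} -
        h / (sqrt (2 * pi) * \<sigma>) / sqrt (card I) * exp (- (x / (\<sigma> * sqrt (card I)))\<^sup>2 / 2)\<bar> \<le> K / card I"
proof -
  define \<phi> where "\<phi> = char (distr M borel (X 1))"
  have X1: "X 1 \<in> borel_measurable M"
    by (rule borel_measurable_X) simp
  obtain C where C: "C > 0"
    "\<And>t. \<bar>t\<bar> \<le> pi / h \<Longrightarrow> cmod (\<phi> t - exp (- \<sigma>\<^sup>2 * t\<^sup>2 / 2)) \<le> C * \<bar>t\<bar> ^ 3"
    using char_approx_gauss[OF X1 third_moment mean second_moment, of "pi / h"] by (auto simp: \<phi>_def)
  obtain c where c: "c > 0" "c \<le> \<sigma>\<^sup>2 / 2" "\<And>t. \<bar>t\<bar> \<le> pi / h \<Longrightarrow> cmod (\<phi> t) \<le> exp (- c * t\<^sup>2)"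
    using norm_char_le_gauss[OF X1 lattice third_moment mean second_moment \<sigma>] by (auto simp: \<phi>_def)
  define K where "K = h / (2 * pi) * (C * exp (c * (pi / h)\<^sup>2) + (h / pi) ^ 3) / c\<^sup>2"
  have "K > 0"
    unfolding K_def using C c h by (intro divide_pos_pos mult_pos_pos add_pos_pos) auto
  moreover have "\<bar>prob {\<omega> \<in> space M. (\<Sum>i\<in>I. X i \<omega>) = x} -
        h / (sqrt (2 * pi) * \<sigma>) / sqrt (card I) * exp (- (x / (\<sigma> * sqrt (card I)))\<^sup>2 / 2)\<bar> \<le> K / card I"
    if I: "finite I" "I \<subseteq> {1..}" "I \<noteq> {}" and x: "x = of_int k * h + real (card I) * b" for I k x
    unfolding K_def
  proof (rule lattice_local_limit[OF borel_measurable_block[OF I(2)] h \<sigma> _ _ _ C(2) c(3) c(1,2)])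
    show "card I > 0" using I by (simp add: card_gt_0_iff)
    show "AE \<omega> in M. \<exists>k::int. (\<Sum>i\<in>I. X i \<omega>) = of_int k * h + x"
      using AE_block_lattice[OF I(1,2)]
    proof eventually_elim
      case (elim \<omega>)
      then obtain l :: int where "(\<Sum>i\<in>I. X i \<omega>) = of_int l * h + real (card I) * b" by blast
      then show ?case
        by (intro exI[of _ "l - k"]) (simp add: x algebra_simps)
    qed
    show "char (distr M borel (\<lambda>\<omega>. \<Sum>i\<in>I. X i \<omega>)) t = \<phi> t ^ card I" for t
    proof -
      have "char (distr M borel (\<lambda>\<omega>. \<Sum>i\<in>I. X i \<omega>)) t = (\<Prod>i\<in>I. char (distr M borel (X i)) t)"
        using I by (intro char_distr_sum indep_vars_subset[OF indep])
      also have "\<dots> = (\<Prod>i\<in>I. \<phi> t)"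
      proof (intro prod.cong refl)
        fix i assume "i \<in> I"
        then have "i \<ge> 1" using I by auto
        then have "distr M borel (X i) = distr M borel (X 1)"
          using iid unfolding iid_def by blast
        then show "char (distr M borel (X i)) t = \<phi> t" by (simp add: \<phi>_def)
      qed
      finally show ?thesis by simp
    qed
  qed (use C in auto)
  ultimately show ?thesis by (rule that)
qed

section \<open>Probabilities of hits and of increments between hits\<close>

lemma sets_hit_event [measurable]: "hit_event M X h b c n \<in> sets M"
  unfolding hit_event_def partial_sum_def
  using borel_measurable_block[of "{1..n}"] by (intro borel_measurable_eq) auto

text \<open>Rounding moves the target by at most \<open>h\<close>, that is by
  \<open>h / (\<sigma> * sqrt n)\<close> after normalisation. By the Lipschitz bound and the
  prefactor of order \<open>1 / sqrt n\<close>, this costs only \<open>O(1/n)\<close>, uniformly in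
  \<open>a\<close>.\<close>

lemma prob_hit_event_approx:
  obtains K where "K > 0"
    "\<And>a n. n \<ge> 1 \<Longrightarrow> \<bar>prob (hit_event M X h b (a * \<sigma>) n) - limit_density h \<sigma> a / sqrt n\<bar> \<le> K / n"
proof -
  obtain K where K: "K > 0"
    "\<And>I k x. finite I \<Longrightarrow> I \<subseteq> {1..} \<Longrightarrow> I \<noteq> {} \<Longrightarrow> x = of_int k * h + real (card I) * b \<Longrightarrow>
      \<bar>prob {\<omega> \<in> space M. (\<Sum>i\<in>I. X i \<omega>) = x} -
        h / (sqrt (2 * pi) * \<sigma>) / sqrt (card I) * exp (- (x / (\<sigma> * sqrt (card I)))\<^sup>2 / 2)\<bar> \<le> K / card I"
    by (rule local_limit) (rule that)
  define L where "L = h / (sqrt (2 * pi) * \<sigma>)"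
  have L: "L > 0" using h \<sigma> by (simp add: L_def)
  have "K + L * h / \<sigma> > 0"
    using K L h \<sigma> by (intro add_pos_pos) auto
  moreover have "\<bar>prob (hit_event M X h b (a * \<sigma>) n) - limit_density h \<sigma> a / sqrt n\<bar> \<le> (K + L * h / \<sigma>) / n"
    if n: "n \<ge> 1" for a n
  proof -
    define x where "x = lattice_round h b (a * \<sigma>) n"
    have "\<bar>x - a * \<sigma> * sqrt n\<bar> \<le> h"
      unfolding x_def by (rule abs_lattice_round_diff_le[OF h])
    moreover have "x / (\<sigma> * sqrt n) - a = (x - a * \<sigma> * sqrt n) / (\<sigma> * sqrt n)"
      using \<sigma> n by (simp add: field_simps)
    ultimately have "\<bar>x / (\<sigma> * sqrt n) - a\<bar> \<le> h / (\<sigma> * sqrt n)"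
      using \<sigma> by (simp add: abs_divide abs_mult divide_right_mono)
    then have "\<bar>exp (- (x / (\<sigma> * sqrt n))\<^sup>2 / 2) - exp (- a\<^sup>2 / 2)\<bar> \<le> h / (\<sigma> * sqrt n)"
      using gauss_lipschitz order_trans by blast
    then have "\<bar>L / sqrt n\<bar> * \<bar>exp (- (x / (\<sigma> * sqrt n))\<^sup>2 / 2) - exp (- a\<^sup>2 / 2)\<bar> \<le> L / sqrt n * (h / (\<sigma> * sqrt n))"
      using L by (intro mult_mono) auto
    also have "\<dots> = L * h / \<sigma> / n"
      using n by (simp add: field_simps)
    finally have "\<bar>L / sqrt n * exp (- (x / (\<sigma> * sqrt n))\<^sup>2 / 2) - L / sqrt n * exp (- a\<^sup>2 / 2)\<bar> \<le> L * h / \<sigma> / n"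
      by (simp only: right_diff_distrib flip: abs_mult)
    moreover have "\<bar>prob (hit_event M X h b (a * \<sigma>) n) - L / sqrt n * exp (- (x / (\<sigma> * sqrt n))\<^sup>2 / 2)\<bar> \<le> K / n"
      using K(2)[of "{1..n}" x "\<lfloor>(a * \<sigma> * sqrt (real n) - real n * b) / h\<rfloor>"] n
      by (simp add: x_def L_def hit_event_def partial_sum_def lattice_round_def)
    moreover have "limit_density h \<sigma> a / sqrt n = L / sqrt n * exp (- a\<^sup>2 / 2)"
      by (simp add: limit_density_def L_def)
    ultimately show ?thesis
      unfolding add_divide_distrib by linarith
  qed
  ultimately show ?thesis by (rule that)
qed

text \<open>Given a hit at \<open>n\<close>, a hit at \<open>n'\<close> means that the increment
  equals the difference of the two targets; sums over disjoint blocks are independent.\<close>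

lemma prob_hit_event_Int:
  assumes n: "n \<le> n'"
  shows "prob (hit_event M X h b c n \<inter> hit_event M X h b c n') = prob (hit_event M X h b c n) *
    prob {\<omega> \<in> space M. (\<Sum>i\<in>{n<..n'}. X i \<omega>) = lattice_round h b c n' - lattice_round h b c n}"
proof -
  let ?I = "{1..n}" and ?J = "{n<..n'}"
  let ?r = "lattice_round h b c n" and ?r' = "lattice_round h b c n'"
  have "indep_var borel ((\<lambda>f. \<Sum>i\<in>?I. f i) \<circ> (\<lambda>\<omega>. restrict (\<lambda>i. X i \<omega>) ?I))
      borel ((\<lambda>f. \<Sum>i\<in>?J. f i) \<circ> (\<lambda>\<omega>. restrict (\<lambda>i. X i \<omega>) ?J))"
    by (intro indep_var_compose[OF indep_var_restrict[OF indep]]) auto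
  then have ind: "indep_var borel (\<lambda>\<omega>. \<Sum>i\<in>?I. X i \<omega>) borel (\<lambda>\<omega>. \<Sum>i\<in>?J. X i \<omega>)"
    by (simp add: o_def)
  have split: "(\<Sum>i=1..n'. X i \<omega>) = (\<Sum>i\<in>?I. X i \<omega>) + (\<Sum>i\<in>?J. X i \<omega>)" for \<omega>
  proof -
    have "{1..n'} = ?I \<union> ?J" using n by auto
    then show ?thesis by (simp only: sum.union_disjoint[OF finite_atLeastAtMost finite_greaterThanAtMost ivl_disj_int_two(8)]) 
  qed
  have "prob (hit_event M X h b c n \<inter> hit_event M X h b c n') =
      prob ((\<lambda>\<omega>. (\<Sum>i\<in>?I. X i \<omega>, \<Sum>i\<in>?J. X i \<omega>)) -` ({?r} \<times> {?r' - ?r}) \<inter> space M)"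
    by (intro arg_cong[where f=prob]) (auto simp: hit_event_def partial_sum_def split simp del: One_nat_def)
  also have "\<dots> = prob ((\<lambda>\<omega>. \<Sum>i\<in>?I. X i \<omega>) -` {?r} \<inter> space M) *
      prob ((\<lambda>\<omega>. \<Sum>i\<in>?J. X i \<omega>) -` {?r' - ?r} \<inter> space M)"
    by (intro indep_varD[OF ind]) auto
  also have "(\<lambda>\<omega>. \<Sum>i\<in>?I. X i \<omega>) -` {?r} \<inter> space M = hit_event M X h b c n"
    by (auto simp: hit_event_def partial_sum_def)
  also have "(\<lambda>\<omega>. \<Sum>i\<in>?J. X i \<omega>) -` {?r' - ?r} \<inter> space M = {\<omega> \<in> space M. (\<Sum>i\<in>?J. X i \<omega>) = ?r' - ?r}"
    by auto
  finally show ?thesis .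
qed

text \<open>With \<open>r\<close>, \<open>s\<close> the square roots of the times and
  \<open>m\<close> their difference, the increment must be close to
  \<open>a * \<sigma> * (s - r)\<close>. Its normalised value differs from \<open>a\<close> by
  \<open>O(N * r / s)\<close> plus a rounding error, so the local limit theorem for the block and
  the Lipschitz bound apply.\<close>

lemma prob_increment_le:
  obtains K where "K > 0"
    "\<And>a N n n'. \<bar>a\<bar> \<le> N \<Longrightarrow> 1 \<le> n \<Longrightarrow> n < n' \<Longrightarrow>
      prob {\<omega> \<in> space M. (\<Sum>i\<in>{n<..n'}. X i \<omega>) =
          lattice_round h b (a * \<sigma>) n' - lattice_round h b (a * \<sigma>) n} \<le>
        limit_density h \<sigma> a / sqrt (real n' - n) +
        K * N * sqrt n / (sqrt n' * sqrt (real n' - n)) + K / (real n' - n)"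
proof -
  obtain K where K: "K > 0"
    "\<And>I k x. finite I \<Longrightarrow> I \<subseteq> {1..} \<Longrightarrow> I \<noteq> {} \<Longrightarrow> x = of_int k * h + real (card I) * b \<Longrightarrow>
      \<bar>prob {\<omega> \<in> space M. (\<Sum>i\<in>I. X i \<omega>) = x} -
        h / (sqrt (2 * pi) * \<sigma>) / sqrt (card I) * exp (- (x / (\<sigma> * sqrt (card I)))\<^sup>2 / 2)\<bar> \<le> K / card I"
    by (rule local_limit) (rule that)
  define L where "L = h / (sqrt (2 * pi) * \<sigma>)"
  have L: "L > 0" using h \<sigma> by (simp add: L_def)
  \<comment> \<open>The middle summand pays for rounding both targets, the last one for replacing
    \<open>(s - r) / sqrt m\<close> by 1.\<close>
  define K' where "K' = K + 2 * L * h / \<sigma> + 2 * L"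
  have K': "K' > 0" "K' \<ge> 2 * L" "K' \<ge> K + 2 * L * h / \<sigma>"
    using K(1) L h \<sigma> by (auto simp: K'_def intro!: add_pos_pos)
  have "prob {\<omega> \<in> space M. (\<Sum>i\<in>{n<..n'}. X i \<omega>) =
          lattice_round h b (a * \<sigma>) n' - lattice_round h b (a * \<sigma>) n} \<le>
        limit_density h \<sigma> a / sqrt (real n' - n) +
        K' * N * sqrt n / (sqrt n' * sqrt (real n' - n)) + K' / (real n' - n)"
    if a: "\<bar>a\<bar> \<le> N" and n: "1 \<le> n" "n < n'" for a N n n'
  proof -
    define r s m where "r = sqrt (real n)" and "s = sqrt (real n')" and "m = real n' - real n"
    have rs: "1 \<le> r" "r < s" "0 < m" "m = (s - r) * (s + r)"
      using n by (auto simp: r_def s_def m_def algebra_simps)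
    define x where "x = lattice_round h b (a * \<sigma>) n' - lattice_round h b (a * \<sigma>) n"
    define y where "y = x / (\<sigma> * sqrt m)"
    have N: "N \<ge> 0" using a by linarith
    have "\<bar>x - a * \<sigma> * (s - r)\<bar> \<le> 2 * h"
      using abs_lattice_round_diff_le[OF h, of b "a * \<sigma>" n'] abs_lattice_round_diff_le[OF h, of b "a * \<sigma>" n]
      by (simp add: x_def r_def s_def algebra_simps)
    moreover have "y - a * (s - r) / sqrt m = (x - a * \<sigma> * (s - r)) / (\<sigma> * sqrt m)"
      using \<sigma> rs(3) by (simp add: y_def field_simps)
    ultimately have 1: "\<bar>y - a * (s - r) / sqrt m\<bar> \<le> 2 * h / (\<sigma> * sqrt m)"
      using \<sigma> rs(3) by (simp add: abs_divide abs_mult divide_right_mono)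
    \<comment> \<open>Since \<open>s - r \<le> sqrt m \<le> s\<close>, the quotient
      \<open>(s - r) / sqrt m\<close> lies between \<open>1 - r / s\<close> and 1.\<close>
    have 2: "\<bar>a * (s - r) / sqrt m - a\<bar> \<le> N * (2 * (r / s))"
    proof -
      have "(s - r)\<^sup>2 \<le> m"
        using rs by (simp add: power2_eq_square mult_left_mono)
      then have up: "(s - r) / sqrt m \<le> 1"
        using rs by (simp add: real_le_rsqrt)
      have "sqrt m \<le> s"
        using rs n by (auto simp: s_def m_def)
      then have "1 - r / s \<le> (s - r) / sqrt m"
        using rs \<open>sqrt m \<le> s\<close> divide_left_mono[of "sqrt m" s "s - r"] by (simp add: diff_divide_distrib)
      moreover have "r / s \<ge> 0" using rs by simp
      ultimately have "\<bar>(s - r) / sqrt m - 1\<bar> \<le> 2 * (r / s)"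
        using up by linarith
      then have "\<bar>a\<bar> * \<bar>(s - r) / sqrt m - 1\<bar> \<le> N * (2 * (r / s))"
        using a by (intro mult_mono) auto
      then show ?thesis
        by (simp add: right_diff_distrib flip: abs_mult)
    qed
    have "\<bar>exp (- y\<^sup>2 / 2) - exp (- a\<^sup>2 / 2)\<bar> \<le> \<bar>y - a\<bar>"
      by (rule gauss_lipschitz)
    then have "exp (- y\<^sup>2 / 2) \<le> exp (- a\<^sup>2 / 2) + (2 * h / (\<sigma> * sqrt m) + N * (2 * (r / s)))"
      using 1 2 by linarith
    then have "L / sqrt m * exp (- y\<^sup>2 / 2) \<le>
        L / sqrt m * (exp (- a\<^sup>2 / 2) + (2 * h / (\<sigma> * sqrt m) + N * (2 * (r / s))))"
      using L rs(3) by (intro mult_left_mono) auto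
    also have "\<dots> = limit_density h \<sigma> a / sqrt m + 2 * L * h / \<sigma> / m + 2 * L * (N * r / (s * sqrt m))"
    proof -
      have "L / q * (E + (2 * h / (\<sigma> * q) + N * (2 * (r / s)))) = L * E / q + 2 * L * h / \<sigma> / (q * q) + 2 * L * (N * r / (s * q))" for E q
        by (simp add: distrib_left mult_ac)
      from this[of "sqrt m" "exp (- a\<^sup>2 / 2)"] have "L / sqrt m * (exp (- a\<^sup>2 / 2) + (2 * h / (\<sigma> * sqrt m) + N * (2 * (r / s)))) =
          L * exp (- a\<^sup>2 / 2) / sqrt m + 2 * L * h / \<sigma> / m + 2 * L * (N * r / (s * sqrt m))"
        using rs(3) by simp
      moreover have "limit_density h \<sigma> a = L * exp (- a\<^sup>2 / 2)"
        by (simp add: limit_density_def L_def)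
      ultimately show ?thesis
        by (simp only:)
    qed
    finally have 3: "L / sqrt m * exp (- y\<^sup>2 / 2) \<le>
        limit_density h \<sigma> a / sqrt m + 2 * L * h / \<sigma> / m + 2 * L * (N * r / (s * sqrt m))" .
    have "\<bar>prob {\<omega> \<in> space M. (\<Sum>i\<in>{n<..n'}. X i \<omega>) = x} - L / sqrt m * exp (- y\<^sup>2 / 2)\<bar> \<le> K / m"
    proof -
      have card: "real (card {n<..n'}) = m"
        using n by (simp add: m_def of_nat_diff)
      \<comment> \<open>The difference of the two floors is an integer, so the target lies on the
        lattice of the block.\<close>
      have x_eq: "x = of_int (\<lfloor>(a * \<sigma> * sqrt (real n') - real n' * b) / h\<rfloor> - \<lfloor>(a * \<sigma> * sqrt (real n) - real n * b) / h\<rfloor>) * h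
          + real (card {n<..n'}) * b"
        unfolding card by (simp add: x_def lattice_round_def m_def algebra_simps)
      show ?thesis
        using K(2)[OF _ _ _ x_eq] n unfolding card by (simp add: y_def L_def subset_eq)
    qed
    then have "prob {\<omega> \<in> space M. (\<Sum>i\<in>{n<..n'}. X i \<omega>) = x} \<le>
        limit_density h \<sigma> a / sqrt m + 2 * L * (N * r / (s * sqrt m)) + (K + 2 * L * h / \<sigma>) / m"
      using 3 by (simp add: add_divide_distrib)
    also have "\<dots> \<le> limit_density h \<sigma> a / sqrt m + K' * (N * r / (s * sqrt m)) + K' / m"
      using K' rs N by (intro add_mono mult_right_mono divide_right_mono) auto
    finally show ?thesis
      by (simp add: x_def r_def s_def m_def mult.assoc)
  qed
  with K'(1) show ?thesis by (rule that)
qed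

end

section \<open>Second moments\<close>

text \<open>Telescoping: rationalising \<open>sqrt (Suc n) - sqrt n\<close> shows that each summand
  is at most twice the corresponding increment of the square root.\<close>

lemma sum_inverse_sqrt_le: "(\<Sum>k=1..n. 1 / sqrt (real k)) \<le> 2 * sqrt (real n)"
proof (induction n)
  case (Suc n)
  let ?r = "sqrt (real n)" and ?s = "sqrt (real (Suc n))"
  have s: "?s > 0" "?r \<le> ?s" by auto
  have "1 = (?s - ?r) * (?s + ?r)" by (simp add: algebra_simps)
  also have "\<dots> \<le> (?s - ?r) * (2 * ?s)" using s by (intro mult_left_mono) auto
  finally have "1 \<le> 2 * (?s - ?r) * ?s" by (simp only: mult_ac)
  then have "1 / ?s \<le> 2 * (?s - ?r)" by (simp only: pos_divide_le_eq[OF s(1)])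
  then show ?case using Suc by simp
qed simp

text \<open>In the application \<open>r i\<close> is the square root of the \<open>i\<close>-th time, so \<open>(r j)\<^sup>2 - (r i)\<^sup>2\<close> is a time increment.\<close>

lemma sum_covariance_bound:
  fixes r :: "nat \<Rightarrow> real"
  assumes \<kappa>: "0 < \<kappa>" "\<kappa> \<le> 1"
    and gap: "\<And>i j. 1 \<le> i \<Longrightarrow> i \<le> j \<Longrightarrow> r j - r i \<ge> \<kappa> * (real j - real i)"
    and r1: "r 1 \<ge> 1" and j: "j \<ge> 1"
  shows "(\<Sum>i=1..<j. 1 / (r j * sqrt ((r j)\<^sup>2 - (r i)\<^sup>2)) + 1 / (r i * ((r j)\<^sup>2 - (r i)\<^sup>2))) \<le> 3 / \<kappa>\<^sup>2 / r j"
proof -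
  have lin: "r i \<ge> \<kappa> * i" if "i \<ge> 1" for i
  proof -
    have "r i \<ge> r 1 + \<kappa> * (real i - 1)" using gap[of 1 i] that by simp
    then show ?thesis using r1 \<kappa> by (simp add: algebra_simps)
  qed
  define s where "s = r j"
  have s: "s \<ge> \<kappa> * j" "s > 0"
    using lin[OF j] j \<kappa> by (auto simp: s_def intro: less_le_trans[of 0 "\<kappa> * j"])
  have incr: "s\<^sup>2 - (r i)\<^sup>2 \<ge> \<kappa> * real (j - i) * s" "r i \<ge> \<kappa> * i" "i \<ge> 1" "j - i \<ge> 1"
    if "i \<in> {1..<j}" for i
  proof -
    have i: "1 \<le> i" "i < j" using that by auto
    then show "i \<ge> 1" "j - i \<ge> 1" "r i \<ge> \<kappa> * i" using lin by auto
    then have "r i \<ge> 0" using \<kappa> by (meson mult_nonneg_nonneg of_nat_0_le_iff order.trans order_less_imp_le)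
    have g: "s - r i \<ge> \<kappa> * real (j - i)" using gap[of i j] i by (simp add: s_def of_nat_diff)
    \<comment> \<open>The difference of squares factors: \<open>s - r i\<close> is at least linear
      in \<open>j - i\<close>, while \<open>s + r i\<close> is at least \<open>s\<close>.\<close>
    have "\<kappa> * real (j - i) * s \<le> (s - r i) * (s + r i)"
    proof (intro mult_mono g)
      have "0 \<le> \<kappa> * real (j - i)" using \<kappa> by simp
      then show "0 \<le> s - r i" using g by linarith
    qed (use s \<open>r i \<ge> 0\<close> in auto)
    then show "s\<^sup>2 - (r i)\<^sup>2 \<ge> \<kappa> * real (j - i) * s" by (simp add: power2_eq_square algebra_simps)
  qed
  \<comment> \<open>Reversing the index by \<open>k = j - i\<close> turns this part into a sum of
    \<open>1 / sqrt k\<close>, of order \<open>sqrt j\<close>; and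
    \<open>j \<le> s / \<kappa>\<close> by linear growth.\<close>
  have "(\<Sum>i=1..<j. 1 / (s * sqrt (s\<^sup>2 - (r i)\<^sup>2))) \<le> (\<Sum>i=1..<j. 1 / (s * sqrt (\<kappa> * s)) * (1 / sqrt (real (j - i))))"
  proof (intro sum_mono)
    fix i assume "i \<in> {1..<j}"
    note i = incr[OF this]
    have "sqrt (\<kappa> * s) * sqrt (real (j - i)) = sqrt (\<kappa> * real (j - i) * s)"
      by (simp add: real_sqrt_mult mult_ac)
    also have "\<dots> \<le> sqrt (s\<^sup>2 - (r i)\<^sup>2)" using i by simp
    finally have "1 / (s * sqrt (s\<^sup>2 - (r i)\<^sup>2)) \<le> 1 / (s * (sqrt (\<kappa> * s) * sqrt (real (j - i))))"
      using s \<kappa> i by (intro frac_le mult_left_mono mult_pos_pos) auto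
    then show "1 / (s * sqrt (s\<^sup>2 - (r i)\<^sup>2)) \<le> 1 / (s * sqrt (\<kappa> * s)) * (1 / sqrt (real (j - i)))"
      by (simp add: mult.assoc)
  qed
  also have "\<dots> = 1 / (s * sqrt (\<kappa> * s)) * (\<Sum>k=1..<j. 1 / sqrt (real k))"
    unfolding sum_distrib_left[symmetric]
    by (intro arg_cong2[where f="(*)"] refl sum.reindex_bij_witness[of _ "\<lambda>i. j - i" "\<lambda>i. j - i"]) auto
  also have "\<dots> \<le> 1 / (s * sqrt (\<kappa> * s)) * (2 * sqrt (s / \<kappa>))"
  proof (intro mult_left_mono)
    have "(\<Sum>k=1..<j. 1 / sqrt (real k)) \<le> (\<Sum>k=1..j. 1 / sqrt (real k))"
      by (intro sum_mono2) auto
    also have "\<dots> \<le> 2 * sqrt (real j)" by (rule sum_inverse_sqrt_le)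
    also have "real j \<le> s / \<kappa>" using s \<kappa> by (simp add: field_simps)
    finally show "(\<Sum>k=1..<j. 1 / sqrt (real k)) \<le> 2 * sqrt (s / \<kappa>)" by simp
  qed (use s \<kappa> in auto)
  also have "\<dots> = 2 / \<kappa> / s"
    using s \<kappa> by (simp add: real_sqrt_mult real_sqrt_divide)
  also have "\<dots> \<le> 2 / \<kappa>\<^sup>2 / s"
    using s \<kappa> by (intro divide_right_mono divide_left_mono) (auto simp: power2_eq_square)
  finally have 1: "(\<Sum>i=1..<j. 1 / (s * sqrt (s\<^sup>2 - (r i)\<^sup>2))) \<le> 2 / \<kappa>\<^sup>2 / s" .
  have "(\<Sum>i=1..<j. 1 / (r i * (s\<^sup>2 - (r i)\<^sup>2))) \<le> (\<Sum>i=1..<j. 1 / \<kappa>\<^sup>2 / s * (1 / real (j - 1)))"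
  proof (intro sum_mono)
    fix i assume "i \<in> {1..<j}"
    note i = incr[OF this]
    \<comment> \<open>The product \<open>i * (j - i)\<close> is smallest at the ends of its range,
      where it equals \<open>j - 1\<close>. Hence each of the \<open>j - 1\<close> summands is at
      most a share \<open>1 / (j - 1)\<close> of the final bound.\<close>
    have "(j - 1) = (i - 1) + (j - i)" using i by simp
    also have "\<dots> \<le> (i - 1) * (j - i) + (j - i)"
      using i mult_le_mono2[of 1 "j - i" "i - 1"] by (intro add_right_mono) simp
    also have "\<dots> = i * (j - i)" using i by (cases i) auto
    finally have "real (j - 1) \<le> real i * real (j - i)" by (simp flip: of_nat_mult)
    then have "\<kappa>\<^sup>2 * s * real (j - 1) \<le> \<kappa>\<^sup>2 * s * (real i * real (j - i))"
      using s by (intro mult_left_mono) auto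
    also have "\<dots> = (\<kappa> * i) * (\<kappa> * real (j - i) * s)" by (simp add: power2_eq_square)
    also have "\<dots> \<le> r i * (s\<^sup>2 - (r i)\<^sup>2)"
      using i \<kappa> s by (intro mult_mono) (auto intro: order_trans[rotated])
    finally have "1 / (r i * (s\<^sup>2 - (r i)\<^sup>2)) \<le> 1 / (\<kappa>\<^sup>2 * s * real (j - 1))"
      using s \<kappa> i \<open>i \<in> {1..<j}\<close> by (intro frac_le mult_pos_pos) auto
    then show "1 / (r i * (s\<^sup>2 - (r i)\<^sup>2)) \<le> 1 / \<kappa>\<^sup>2 / s * (1 / real (j - 1))"
      by (simp add: mult.assoc)
  qed
  \<comment> \<open>For \<open>j = 1\<close> the sum is empty and the quotient is 0 by the
    convention for division by zero.\<close>
  also have "\<dots> = 1 / \<kappa>\<^sup>2 / s * (real (j - 1) / real (j - 1))" by simp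
  also have "\<dots> \<le> 1 / \<kappa>\<^sup>2 / s"
    using s by (intro mult_left_le) (auto simp: divide_self_if simp del: of_nat_diff)
  finally have 2: "(\<Sum>i=1..<j. 1 / (r i * (s\<^sup>2 - (r i)\<^sup>2))) \<le> 1 / \<kappa>\<^sup>2 / s" .
  have "3 / \<kappa>\<^sup>2 / s = 2 / \<kappa>\<^sup>2 / s + 1 / \<kappa>\<^sup>2 / s"
    by (simp flip: add_divide_distrib)
  then show ?thesis
    using add_mono[OF 1 2] unfolding sum.distrib s_def[symmetric] by (simp only:)
qed

text \<open>Adding one index contributes its diagonal term and twice its products with all earlier
  indices. Upper bounds on these suffice, even where the products have negative mean.\<close>

lemma (in prob_space) second_moment_sum_le:
  fixes Z :: "nat \<Rightarrow> 'a \<Rightarrow> real"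
  assumes int: "\<And>i j. i \<ge> 1 \<Longrightarrow> j \<ge> 1 \<Longrightarrow> integrable M (\<lambda>\<omega>. Z i \<omega> * Z j \<omega>)"
    and diag: "\<And>j. j \<ge> 1 \<Longrightarrow> expectation (\<lambda>\<omega>. Z j \<omega> * Z j \<omega>) \<le> d j"
    and off: "\<And>j. j \<ge> 1 \<Longrightarrow> (\<Sum>i=1..<j. expectation (\<lambda>\<omega>. Z i \<omega> * Z j \<omega>)) \<le> e j"
  shows "expectation (\<lambda>\<omega>. (\<Sum>i=1..n. Z i \<omega>)\<^sup>2) \<le> (\<Sum>j=1..n. d j + 2 * e j)"
proof (induction n)
  case (Suc n)
  have sq: "(\<Sum>i=1..Suc n. Z i \<omega>)\<^sup>2 = (\<Sum>i=1..n. Z i \<omega>)\<^sup>2 + 2 * (\<Sum>i=1..n. Z i \<omega> * Z (Suc n) \<omega>) + Z (Suc n) \<omega> * Z (Suc n) \<omega>" for \<omega>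
    by (simp add: power2_eq_square algebra_simps sum_distrib_left sum_distrib_right)
  have i1: "integrable M (\<lambda>\<omega>. (\<Sum>i=1..n. Z i \<omega>)\<^sup>2)"
    unfolding power2_eq_square sum_product by (intro Bochner_Integration.integrable_sum int) auto
  have i2: "integrable M (\<lambda>\<omega>. \<Sum>i=1..n. Z i \<omega> * Z (Suc n) \<omega>)"
    by (intro Bochner_Integration.integrable_sum int) auto
  have "expectation (\<lambda>\<omega>. (\<Sum>i=1..Suc n. Z i \<omega>)\<^sup>2) = expectation (\<lambda>\<omega>. (\<Sum>i=1..n. Z i \<omega>)\<^sup>2)
      + 2 * (\<Sum>i=1..n. expectation (\<lambda>\<omega>. Z i \<omega> * Z (Suc n) \<omega>)) + expectation (\<lambda>\<omega>. Z (Suc n) \<omega> * Z (Suc n) \<omega>)"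
    unfolding sq using i1 i2 int by (simp add: Bochner_Integration.integral_sum)
  also have "\<dots> \<le> (\<Sum>j=1..n. d j + 2 * e j) + 2 * e (Suc n) + d (Suc n)"
    using Suc off[of "Suc n"] diag[of "Suc n"]
    by (intro add_mono mult_left_mono) (auto simp: atLeastLessThanSuc_atLeastAtMost)
  finally show ?case by simp
qed simp

section \<open>Second moments of the centred hit counts\<close>

context lattice_walk
begin

lemma integrable_indicator_hit_event [simp]:
  "integrable M (indicat_real (hit_event M X h b c n))"
  "integrable M (indicat_real (hit_event M X h b c n \<inter> hit_event M X h b c n'))"
  using sets_hit_event by (auto intro!: integrable_real_indicator simp: emeasure_eq_measure)

text \<open>The indicators are centred at the limiting value
  \<open>limit_density h \<sigma> a / sqrt n\<close>, not at their means. After factoring out a hit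
  at \<open>n\<close>, what matters is how far that hit raises the chance of one at
  \<open>n'\<close>; leading terms cancel up to the gap between \<open>1 / sqrt (n' - n)\<close> and
  \<open>1 / sqrt n'\<close>.\<close>

lemma covariance_hit_event_le:
  assumes N: "N > 0"
  obtains K where "K > 0"
    "\<And>a n n'. \<bar>a\<bar> \<le> N \<Longrightarrow> 1 \<le> n \<Longrightarrow> n < n' \<Longrightarrow>
      expectation (\<lambda>\<omega>. (indicator (hit_event M X h b (a * \<sigma>) n) \<omega> - limit_density h \<sigma> a / sqrt n) *
        (indicator (hit_event M X h b (a * \<sigma>) n') \<omega> - limit_density h \<sigma> a / sqrt n')) \<le>
      K * (1 / (sqrt n' * sqrt (real n' - n)) + 1 / (sqrt n * (real n' - n)))"
    "\<And>a n. \<bar>a\<bar> \<le> N \<Longrightarrow> 1 \<le> n \<Longrightarrow>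
      expectation (\<lambda>\<omega>. (indicator (hit_event M X h b (a * \<sigma>) n) \<omega> - limit_density h \<sigma> a / sqrt n) *
        (indicator (hit_event M X h b (a * \<sigma>) n) \<omega> - limit_density h \<sigma> a / sqrt n)) \<le> K / sqrt n"
proof -
  obtain K1 where K1: "K1 > 0"
    "\<And>a n. n \<ge> 1 \<Longrightarrow> \<bar>prob (hit_event M X h b (a * \<sigma>) n) - limit_density h \<sigma> a / sqrt n\<bar> \<le> K1 / n"
    by (rule prob_hit_event_approx) (rule that)
  obtain K2 where K2: "K2 > 0"
    "\<And>a N n n'. \<bar>a\<bar> \<le> N \<Longrightarrow> 1 \<le> n \<Longrightarrow> n < n' \<Longrightarrow>
      prob {\<omega> \<in> space M. (\<Sum>i\<in>{n<..n'}. X i \<omega>) =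
          lattice_round h b (a * \<sigma>) n' - lattice_round h b (a * \<sigma>) n} \<le>
        limit_density h \<sigma> a / sqrt (real n' - n) +
        K2 * N * sqrt n / (sqrt n' * sqrt (real n' - n)) + K2 / (real n' - n)"
    by (rule prob_increment_le) (rule that)
  define L where "L = h / (sqrt (2 * pi) * \<sigma>)"
  have L: "L > 0" using h \<sigma> by (simp add: L_def)
  have dens: "0 \<le> limit_density h \<sigma> a" "limit_density h \<sigma> a \<le> L" for a
  proof -
    have eq: "limit_density h \<sigma> a = L * exp (- a\<^sup>2 / 2)" by (simp add: limit_density_def L_def)
    show "0 \<le> limit_density h \<sigma> a" using L by (simp add: eq)
    show "limit_density h \<sigma> a \<le> L" unfolding eq using L by (intro mult_left_le) auto
  qed
  let ?H = "\<lambda>a n. hit_event M X h b (a * \<sigma>) n"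
  let ?d = "\<lambda>a. limit_density h \<sigma> a"
  have p_le: "prob (?H a n) \<le> (K1 + L) / sqrt n" if "n \<ge> 1" for a n
  proof -
    have "1 \<le> sqrt n" using that by simp
    then have "sqrt n \<le> n" using mult_left_mono[of 1 "sqrt n" "sqrt n"] by simp
    then have "K1 / n \<le> K1 / sqrt n"
      using that K1(1) by (intro divide_left_mono) auto
    moreover have "?d a / sqrt n \<le> L / sqrt n" using dens by (intro divide_right_mono) auto
    ultimately show ?thesis using K1(2)[OF that, of a] by (simp add: add_divide_distrib)
  qed
  define R where "R = L + K2 * N + K2 + K1"
  have R: "R > 0" using L K2 K1 N by (simp add: R_def add_pos_pos)
  define K where "K = (K1 + L) * R + K1\<^sup>2 + (K1 + L) + L\<^sup>2"
  have K: "K > 0" using L K1 R by (simp add: K_def add_pos_pos)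
  note K
  moreover have "expectation (\<lambda>\<omega>. (indicator (?H a n) \<omega> - ?d a / sqrt n) * (indicator (?H a n') \<omega> - ?d a / sqrt n')) \<le>
      K * (1 / (sqrt n' * sqrt (real n' - n)) + 1 / (sqrt n * (real n' - n)))"
    if a: "\<bar>a\<bar> \<le> N" and n: "1 \<le> n" "n < n'" for a n n'
  proof -
    define r s m where "r = sqrt (real n)" and "s = sqrt (real n')" and "m = real n' - real n"
    have rs: "1 \<le> r" "r < s" "0 < m" "m = s\<^sup>2 - r\<^sup>2" "real n = r\<^sup>2" "real n' = s\<^sup>2"
      using n by (auto simp: r_def s_def m_def)
    define D where "D = ?d a"
    have D: "0 \<le> D" "D \<le> L" using dens by (auto simp: D_def)
    define p p' q where "p = prob (?H a n)" and "p' = prob (?H a n')" and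
      "q = prob {\<omega> \<in> space M. (\<Sum>i\<in>{n<..n'}. X i \<omega>) =
          lattice_round h b (a * \<sigma>) n' - lattice_round h b (a * \<sigma>) n}"
    have "expectation (\<lambda>\<omega>. (indicator (?H a n) \<omega> - D / r) * (indicator (?H a n') \<omega> - D / s)) =
        expectation (\<lambda>\<omega>. indicator (?H a n \<inter> ?H a n') \<omega> - D / s * indicator (?H a n) \<omega> - D / r * indicator (?H a n') \<omega> + D / r * (D / s))"
      by (intro Bochner_Integration.integral_cong) (auto simp: algebra_simps indicator_inter_arith)
    also have "\<dots> = p * q - D / s * p - D / r * p' + D / r * (D / s)"
      using n prob_hit_event_Int[of n n' "a * \<sigma>"] by (simp add: p_def q_def p'_def prob_space)
    \<comment> \<open>Adding and subtracting \<open>p * p'\<close> separates the dependence of the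
      hits from the product of the two centring errors, each of which is given by the local limit
      theorem.\<close>
    also have "\<dots> = p * (q - p') + (p - D / r) * (p' - D / s)"
      by (simp add: algebra_simps)
    also have "\<dots> \<le> (K1 + L) / r * (R * (r / (s * sqrt m) + 1 / m)) + K1 / r\<^sup>2 * (K1 / s\<^sup>2)"
    proof (intro add_mono)
      have mpos: "sqrt m > 0" using rs by simp
      have m_le: "m \<le> s\<^sup>2" using rs by simp
      \<comment> \<open>From \<open>s\<^sup>2 = m + r\<^sup>2\<close> one gets
        \<open>s - sqrt m \<le> r\<close>, which bounds the gap between \<open>1 / sqrt m\<close>
        and \<open>1 / s\<close>.\<close>
      have "s\<^sup>2 \<le> (sqrt m + r)\<^sup>2" using rs mpos by (simp add: power2_sum)
      then have "s \<le> sqrt m + r" by (rule power2_le_imp_le) (use mpos rs(1) in linarith)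
      then have "(s - sqrt m) / (s * sqrt m) \<le> r / (s * sqrt m)"
        using rs mpos by (intro divide_right_mono) auto
      moreover have "1 / sqrt m - 1 / s = (s - sqrt m) / (s * sqrt m)"
        using rs mpos by (simp add: field_simps)
      ultimately have g: "1 / sqrt m - 1 / s \<le> r / (s * sqrt m)" by simp
      have "D * (1 / sqrt m - 1 / s) \<le> D * (r / (s * sqrt m))"
        using g D by (intro mult_left_mono)
      also have "\<dots> \<le> L * (r / (s * sqrt m))"
        using rs mpos D by (intro mult_right_mono) auto
      finally have g': "D * (1 / sqrt m - 1 / s) \<le> L * (r / (s * sqrt m))" .
      have "q \<le> D / sqrt m + K2 * N * (r / (s * sqrt m)) + K2 / m"
        using K2(2)[OF a n] by (simp add: q_def D_def r_def s_def m_def)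
      moreover have "D / s - p' \<le> K1 / s\<^sup>2"
        using K1(2)[of n' a] n unfolding p'_def D_def s_def by (simp add: abs_le_iff)
      moreover have "K1 / s\<^sup>2 \<le> K1 / m"
        using K1 m_le rs by (intro divide_left_mono) auto
      moreover have "D * (1 / sqrt m - 1 / s) = D / sqrt m - D / s" by (simp add: algebra_simps)
      ultimately have "q - p' \<le> (L + K2 * N) * (r / (s * sqrt m)) + (K2 + K1) * (1 / m)"
        using g' by (simp add: distrib_right add_divide_distrib)
      also have "\<dots> \<le> R * (r / (s * sqrt m)) + R * (1 / m)"
        using rs mpos L K1 K2 N by (intro add_mono mult_right_mono) (auto simp: R_def)
      also have "\<dots> = R * (r / (s * sqrt m) + 1 / m)" by (simp add: algebra_simps)
      finally have "p * (q - p') \<le> p * (R * (r / (s * sqrt m) + 1 / m))"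
        by (intro mult_left_mono) (auto simp: p_def)
      also have "\<dots> \<le> (K1 + L) / r * (R * (r / (s * sqrt m) + 1 / m))"
      proof (intro mult_right_mono)
        show "p \<le> (K1 + L) / r" unfolding p_def r_def by (rule p_le[OF n(1)])
        show "0 \<le> R * (r / (s * sqrt m) + 1 / m)"
          using R rs(1-3) by simp
      qed
      finally show "p * (q - p') \<le> (K1 + L) / r * (R * (r / (s * sqrt m) + 1 / m))" .
      have "\<bar>p - D / r\<bar> * \<bar>p' - D / s\<bar> \<le> K1 / r\<^sup>2 * (K1 / s\<^sup>2)"
      proof (intro mult_mono)
        show "\<bar>p - D / r\<bar> \<le> K1 / r\<^sup>2"
          using K1(2)[OF n(1), of a] by (simp add: p_def D_def r_def)
        show "\<bar>p' - D / s\<bar> \<le> K1 / s\<^sup>2"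
          using K1(2)[of n' a] n by (simp add: p'_def D_def s_def)
      qed (use K1(1) in auto)
      then show "(p - D / r) * (p' - D / s) \<le> K1 / r\<^sup>2 * (K1 / s\<^sup>2)"
        by (metis abs_ge_self abs_mult order_trans)
    qed
    also have "K1 / r\<^sup>2 * (K1 / s\<^sup>2) \<le> K1\<^sup>2 * (1 / (r * m))"
    proof -
      have "r * m \<le> r\<^sup>2 * s\<^sup>2"
      proof (intro mult_mono)
        show "r \<le> r\<^sup>2" using rs(1) by (simp add: power2_eq_square)
        show "m \<le> s\<^sup>2" using rs(4) by simp
      qed (use rs(3) in auto)
      then have "K1\<^sup>2 / (r\<^sup>2 * s\<^sup>2) \<le> K1\<^sup>2 / (r * m)"
        using rs(1-3) by (intro divide_left_mono) auto
      then show ?thesis by (simp add: power2_eq_square)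
    qed
    also have "(K1 + L) / r * (R * (r / (s * sqrt m) + 1 / m)) + K1\<^sup>2 * (1 / (r * m)) =
        (K1 + L) * R * (1 / (s * sqrt m)) + ((K1 + L) * R + K1\<^sup>2) * (1 / (r * m))"
      using rs(1-3) by (simp add: field_simps)
    also have "\<dots> \<le> K * (1 / (s * sqrt m)) + K * (1 / (r * m))"
    proof (intro add_mono mult_right_mono)
      show "(K1 + L) * R \<le> K" "(K1 + L) * R + K1\<^sup>2 \<le> K"
        using L K1(1) by (simp_all add: K_def)
    qed (use rs(1-3) in auto)
    also have "\<dots> = K * (1 / (s * sqrt m) + 1 / (r * m))" by (simp only: distrib_left)
    finally show ?thesis by (simp add: D_def r_def s_def m_def)
  qed
  moreover have "expectation (\<lambda>\<omega>. (indicator (?H a n) \<omega> - ?d a / sqrt n) * (indicator (?H a n) \<omega> - ?d a / sqrt n)) \<le> K / sqrt n"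
    if a: "\<bar>a\<bar> \<le> N" and n: "1 \<le> n" for a n
  proof -
    define r where "r = sqrt (real n)"
    have r: "r \<ge> 1" using n by (simp add: r_def)
    define D where "D = ?d a"
    have D: "0 \<le> D" "D \<le> L" using dens by (auto simp: D_def)
    \<comment> \<open>For an indicator \<open>x\<close> and \<open>y \<ge> 0\<close>, expanding the
      square gives \<open>(x - y)\<^sup>2 \<le> x + y\<^sup>2\<close>.\<close>
    have "expectation (\<lambda>\<omega>. (indicator (?H a n) \<omega> - D / r) * (indicator (?H a n) \<omega> - D / r)) \<le>
        expectation (\<lambda>\<omega>. indicator (?H a n) \<omega> + D / r * (D / r))"
    proof (intro integral_mono)
      show "(indicator (?H a n) \<omega> - D / r) * (indicator (?H a n) \<omega> - D / r) \<le> indicator (?H a n) \<omega> + D / r * (D / r)" for \<omega>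
        using D r by (auto simp: indicator_def algebra_simps)
      show "integrable M (\<lambda>\<omega>. (indicat_real (?H a n) \<omega> - D / r) * (indicator (?H a n) \<omega> - D / r))"
        unfolding left_diff_distrib right_diff_distrib by (auto simp flip: indicator_inter_arith)
    qed auto
    also have "\<dots> = prob (?H a n) + D / r * (D / r)" by (simp add: prob_space)
    also have "\<dots> \<le> (K1 + L) / r + L / 1 * (L / r)"
      using p_le[OF n] D r L unfolding r_def[symmetric]
      by (intro add_mono mult_mono frac_le) auto
    also have "\<dots> = ((K1 + L) + L\<^sup>2) / r" by (simp add: power2_eq_square add_divide_distrib)
    also have "\<dots> \<le> K / r"
      using r R K1 L by (intro divide_right_mono) (auto simp: K_def)
    finally show ?thesis by (simp add: D_def r_def)
  qed
  ultimately show ?thesis by (rule that)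
qed

text \<open>For each \<open>j\<close>, the products with all earlier indices sum to
  \<open>O(1 / sqrt (ns j))\<close>, the same order as the diagonal term. The second moment is thus
  linear in the normalising sum, uniformly for \<open>\<bar>a\<bar> \<le> N\<close>.\<close>

lemma second_moment_hit_count_le:
  fixes ns :: "nat \<Rightarrow> nat"
  assumes N: "N > 0" and \<kappa>: "0 < \<kappa>" "\<kappa> \<le> 1"
    and gap: "\<And>i j. 1 \<le> i \<Longrightarrow> i \<le> j \<Longrightarrow> sqrt (ns j) - sqrt (ns i) \<ge> \<kappa> * (real j - real i)"
    and ns1: "ns 1 \<ge> 1"
  obtains K where "K > 0"
    "\<And>a n. \<bar>a\<bar> \<le> N \<Longrightarrow> expectation (\<lambda>\<omega>. (\<Sum>i=1..n. indicator (hit_event M X h b (a * \<sigma>) (ns i)) \<omega>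
        - limit_density h \<sigma> a / sqrt (ns i))\<^sup>2) \<le> K * (\<Sum>i=1..n. 1 / sqrt (ns i))"
proof -
  obtain K where K: "K > 0"
    "\<And>a n n'. \<bar>a\<bar> \<le> N \<Longrightarrow> 1 \<le> n \<Longrightarrow> n < n' \<Longrightarrow>
      expectation (\<lambda>\<omega>. (indicator (hit_event M X h b (a * \<sigma>) n) \<omega> - limit_density h \<sigma> a / sqrt n) *
        (indicator (hit_event M X h b (a * \<sigma>) n') \<omega> - limit_density h \<sigma> a / sqrt n')) \<le>
      K * (1 / (sqrt n' * sqrt (real n' - n)) + 1 / (sqrt n * (real n' - n)))"
    "\<And>a n. \<bar>a\<bar> \<le> N \<Longrightarrow> 1 \<le> n \<Longrightarrow>
      expectation (\<lambda>\<omega>. (indicator (hit_event M X h b (a * \<sigma>) n) \<omega> - limit_density h \<sigma> a / sqrt n) *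
        (indicator (hit_event M X h b (a * \<sigma>) n) \<omega> - limit_density h \<sigma> a / sqrt n)) \<le> K / sqrt n"
    by (rule covariance_hit_event_le[OF N]) (rule that)
  have ns: "ns i < ns j" if "1 \<le> i" "i < j" for i j
  proof -
    have "0 < \<kappa> * (real j - real i)" using \<kappa> that by simp
    then have "sqrt (ns i) < sqrt (ns j)" using gap[of i j] that by linarith
    then show ?thesis by simp
  qed
  have ns_ge: "1 \<le> ns i" if "1 \<le> i" for i
    using ns[of 1 i] ns1 that by (cases "i = 1") auto
  define K' where "K' = K + 2 * (K * (3 / \<kappa>\<^sup>2))"
  have "K' > 0" using K \<kappa> by (simp add: K'_def add_pos_pos)
  moreover have "expectation (\<lambda>\<omega>. (\<Sum>i=1..n. indicator (hit_event M X h b (a * \<sigma>) (ns i)) \<omega>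
        - limit_density h \<sigma> a / sqrt (ns i))\<^sup>2) \<le> K' * (\<Sum>i=1..n. 1 / sqrt (ns i))"
    if a: "\<bar>a\<bar> \<le> N" for a n
  proof -
    define Z where "Z i \<omega> = indicator (hit_event M X h b (a * \<sigma>) (ns i)) \<omega> - limit_density h \<sigma> a / sqrt (ns i)"
      for i \<omega>
    have "expectation (\<lambda>\<omega>. (\<Sum>i=1..n. Z i \<omega>)\<^sup>2) \<le> (\<Sum>j=1..n. K / sqrt (ns j) + 2 * (K * (3 / \<kappa>\<^sup>2 / sqrt (ns j))))"
    proof (rule second_moment_sum_le)
      show "integrable M (\<lambda>\<omega>. Z i \<omega> * Z j \<omega>)" for i j
        unfolding Z_def left_diff_distrib right_diff_distrib by (auto simp flip: indicator_inter_arith)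
      show "expectation (\<lambda>\<omega>. Z j \<omega> * Z j \<omega>) \<le> K / sqrt (ns j)" if "j \<ge> 1" for j
        unfolding Z_def using a ns_ge[OF that] by (rule K(3))
      fix j :: nat assume j: "j \<ge> 1"
      have "(\<Sum>i=1..<j. expectation (\<lambda>\<omega>. Z i \<omega> * Z j \<omega>)) \<le>
          (\<Sum>i=1..<j. K * (1 / (sqrt (ns j) * sqrt (real (ns j) - ns i)) + 1 / (sqrt (ns i) * (real (ns j) - ns i))))"
        unfolding Z_def using a ns ns_ge by (intro sum_mono K(2)) auto
      also have "\<dots> = K * (\<Sum>i=1..<j. 1 / (sqrt (ns j) * sqrt ((sqrt (ns j))\<^sup>2 - (sqrt (ns i))\<^sup>2)) +
          1 / (sqrt (ns i) * ((sqrt (ns j))\<^sup>2 - (sqrt (ns i))\<^sup>2)))"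
        by (simp add: sum_distrib_left)
      also have "\<dots> \<le> K * (3 / \<kappa>\<^sup>2 / sqrt (ns j))"
        using K(1) \<kappa> gap ns1 j by (intro mult_left_mono sum_covariance_bound[where r="\<lambda>i. sqrt (ns i)"]) auto
      finally show "(\<Sum>i=1..<j. expectation (\<lambda>\<omega>. Z i \<omega> * Z j \<omega>)) \<le> K * (3 / \<kappa>\<^sup>2 / sqrt (ns j))" .
    qed
    also have "\<dots> = K' * (\<Sum>i=1..n. 1 / sqrt (ns i))"
      unfolding K'_def sum_distrib_left by (intro sum.cong) (auto simp: algebra_simps)
    finally show ?thesis by (simp add: Z_def)
  qed
  ultimately show ?thesis by (rule that)
qed

end

section \<open>Laws of large numbers and growth conditions\<close>

text \<open>Markov's inequality for the square: Chebyshev's bound about 0, since \<open>D\<close>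
  will be centred at an asymptotic value rather than at its mean.\<close>

lemma (in prob_space) prob_abs_ge_le_second_moment:
  assumes "integrable M (\<lambda>\<omega>. (D \<omega>)\<^sup>2)" and "D \<in> borel_measurable M" and c: "c > (0::real)"
  shows "prob {\<omega> \<in> space M. \<bar>D \<omega>\<bar> \<ge> c} \<le> expectation (\<lambda>\<omega>. (D \<omega>)\<^sup>2) / c\<^sup>2"
proof -
  have "{\<omega> \<in> space M. \<bar>D \<omega>\<bar> \<ge> c} = {\<omega> \<in> space M. (D \<omega>)\<^sup>2 \<ge> c\<^sup>2}"
    using c by (auto simp flip: abs_le_square_iff)
  moreover have "prob {\<omega> \<in> space M. (D \<omega>)\<^sup>2 \<ge> c\<^sup>2} \<le> expectation (\<lambda>\<omega>. (D \<omega>)\<^sup>2) / c\<^sup>2"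
    using assms by (intro integral_Markov_inequality_measure[where A="space M - space M"]) auto
  ultimately show ?thesis by simp
qed

text \<open>When \<open>B n\<close> lies between consecutive squares, monotonicity traps
  \<open>T n / B n\<close> between the ratios at two consecutive times \<open>N j\<close>, up to
  factors tending to 1. Squares are sparse enough for Borel-Cantelli, yet successive squares have
  ratio tending to 1.\<close>

lemma tendsto_along_squares:
  fixes T B :: "nat \<Rightarrow> real" and N :: "nat \<Rightarrow> nat"
  assumes mono: "mono T" "mono B" and T0: "\<And>n. T n \<ge> 0"
    and B: "filterlim B at_top sequentially"
    and N: "\<And>k n. N k \<le> n \<longleftrightarrow> B n \<ge> (real k + 1)\<^sup>2" "\<And>k. B (N k) \<le> (real k + 1)\<^sup>2 + 1"
    and lim: "(\<lambda>k. T (N k) / B (N k)) \<longlonglongrightarrow> L"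
  shows "(\<lambda>n. T n / B n) \<longlonglongrightarrow> L"
proof -
  \<comment> \<open>Once \<open>B n \<ge> 1\<close>, \<open>j = k n\<close> satisfies
    \<open>(j + 1)\<^sup>2 \<le> B n < (j + 2)\<^sup>2\<close>; the subtracted 1 matches the shift
    in \<open>N\<close>.\<close>
  define k where "k n = nat \<lfloor>sqrt (B n)\<rfloor> - 1" for n
  \<comment> \<open>The extra 1 in the numerator is the overshoot of \<open>B\<close> at the time
    when it passes the square.\<close>
  define u where "u k = T (N (Suc k)) / B (N (Suc k)) * (((real k + 2)\<^sup>2 + 1) / (real k + 1)\<^sup>2)" for k
  define l where "l k = T (N k) / B (N k) * ((real k + 1)\<^sup>2 / (real k + 2)\<^sup>2)" for k
  have k: "filterlim k at_top sequentially"
  proof -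
    have "filterlim (\<lambda>x. nat \<lfloor>sqrt x\<rfloor> - 1) at_top (at_top :: real filter)"
      unfolding filterlim_at_top
    proof
      fix z
      show "\<forall>\<^sub>F x in (at_top :: real filter). z \<le> nat \<lfloor>sqrt x\<rfloor> - 1"
        using eventually_ge_at_top[of "(real z + 1)\<^sup>2"]
      proof eventually_elim
        case (elim x)
        then have "sqrt x \<ge> real z + 1" by (simp add: real_le_rsqrt)
        then have "\<lfloor>sqrt x\<rfloor> \<ge> int z + 1" by (simp add: le_floor_iff)
        then show ?case by linarith
      qed
    qed
    from filterlim_compose[OF this B] show ?thesis by (simp add: k_def[abs_def])
  qed
  have "(\<lambda>k. ((real k + 2)\<^sup>2 + 1) / (real k + 1)\<^sup>2) \<longlonglongrightarrow> 1" by real_asymp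
  then have "u \<longlonglongrightarrow> L * 1"
    unfolding u_def using lim by (intro tendsto_mult LIMSEQ_Suc)
  then have u: "(\<lambda>n. u (k n)) \<longlonglongrightarrow> L"
    using filterlim_compose[OF _ k] by simp
  have "(\<lambda>k. (real k + 1)\<^sup>2 / (real k + 2)\<^sup>2) \<longlonglongrightarrow> 1" by real_asymp
  then have "l \<longlonglongrightarrow> L * 1"
    unfolding l_def using lim by (intro tendsto_mult)
  then have l: "(\<lambda>n. l (k n)) \<longlonglongrightarrow> L"
    using filterlim_compose[OF _ k] by simp
  have ev: "\<forall>\<^sub>F n in sequentially. l (k n) \<le> T n / B n \<and> T n / B n \<le> u (k n)"
    using filterlim_at_top[THEN iffD1, OF B, rule_format, of 1]
  proof eventually_elim
    case (elim n)
    define j where "j = k n"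
    have "1 \<le> sqrt (B n)" using elim by simp
    then have "real j + 1 = of_int \<lfloor>sqrt (B n)\<rfloor>"
      by (simp add: j_def k_def of_nat_diff le_nat_iff le_floor_iff)
    then have j: "real j + 1 \<le> sqrt (B n)" "sqrt (B n) < real j + 2" by linarith+
    have "(real j + 1)\<^sup>2 \<le> (sqrt (B n))\<^sup>2" using j by (intro power_mono) auto
    then have lo: "(real j + 1)\<^sup>2 \<le> B n" using elim by simp
    have "(sqrt (B n))\<^sup>2 < (real j + 2)\<^sup>2" using j elim by (intro power_strict_mono) auto
    then have up: "B n < (real j + 2)\<^sup>2" using elim by simp
    have N1: "N j \<le> n" using lo N(1) by simp
    define N' where "N' = N (Suc j)"
    have Bj: "B (N j) \<ge> (real j + 1)\<^sup>2" "B N' \<ge> (real j + 2)\<^sup>2" "B N' \<le> (real j + 2)\<^sup>2 + 1"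
      using N(1)[of j "N j"] N(1)[of "Suc j" N'] N(2)[of "Suc j"]
      by (auto simp: N'_def add.commute add.left_commute)
    have pos: "B n > 0" "(real j + 1)\<^sup>2 > 0" "(real j + 2)\<^sup>2 > 0" using elim by auto
    have posj: "B (N j) > 0" "B N' > 0"
      using Bj(1,2) pos by linarith+
    have "l j \<le> T (N j) / (real j + 1)\<^sup>2 * ((real j + 1)\<^sup>2 / (real j + 2)\<^sup>2)"
      unfolding l_def using Bj(1) T0 pos posj by (intro mult_right_mono divide_left_mono mult_pos_pos) auto
    also have "\<dots> = T (N j) / (real j + 2)\<^sup>2" using pos by simp
    also have "\<dots> \<le> T (N j) / B n"
      using up pos T0 by (intro divide_left_mono mult_pos_pos) auto
    also have "\<dots> \<le> T n / B n" using N1 mono(1) pos by (intro divide_right_mono) (auto dest: monoD)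
    finally have 1: "l j \<le> T n / B n" .
    have "\<not> N' \<le> n"
      unfolding N'_def N(1) using up by (simp add: add.commute add.left_commute)
    then have "T n \<le> T N'" using mono(1) by (simp add: monoD)
    then have "T n / B n \<le> T N' / (real j + 1)\<^sup>2"
      using lo pos T0 by (intro frac_le) auto
    also have "\<dots> = T N' / B N' * (B N' / (real j + 1)\<^sup>2)" using posj by simp
    also have "\<dots> \<le> u j"
      unfolding u_def N'_def[symmetric] using Bj(3) T0 posj by (intro mult_left_mono divide_right_mono) auto
    finally show ?case using 1 by (simp add: j_def)
  qed
  show ?thesis
    by (rule tendsto_sandwich[OF _ _ l u]) (use ev in \<open>auto elim: eventually_mono\<close>)
qed

text \<open>At the first time when the weights sum to \<open>(k + 1)\<^sup>2\<close>, Chebyshev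
  bounds the probability of a relative deviation by a multiple of
  \<open>1 / (k + 1)\<^sup>2\<close>. Borel-Cantelli gives convergence along these times. Weights of
  at most 1 limit the overshoot, and monotone sums fill the gaps.\<close>

lemma (in prob_space) AE_ratio_tendsto:
  fixes Y :: "nat \<Rightarrow> 'a \<Rightarrow> real" and w :: "nat \<Rightarrow> real"
  assumes Y: "\<And>i. Y i \<in> borel_measurable M" "\<And>i \<omega>. 0 \<le> Y i \<omega>" "\<And>i \<omega>. Y i \<omega> \<le> 1"
    and w: "\<And>i. i \<ge> 1 \<Longrightarrow> 0 \<le> w i" "\<And>i. i \<ge> 1 \<Longrightarrow> w i \<le> 1"
    and div: "filterlim (\<lambda>n. \<Sum>i=1..n. w i) at_top sequentially"
    and bound: "\<And>n. expectation (\<lambda>\<omega>. (\<Sum>i=1..n. Y i \<omega> - L * w i)\<^sup>2) \<le> K * (\<Sum>i=1..n. w i)"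
  shows "AE \<omega> in M. (\<lambda>n. (\<Sum>i=1..n. Y i \<omega>) / (\<Sum>i=1..n. w i)) \<longlonglongrightarrow> L"
proof -
  define B where "B n = (\<Sum>i=1..n. w i)" for n
  define D where "D n \<omega> = (\<Sum>i=1..n. Y i \<omega> - L * w i)" for n \<omega>
  define N where "N k = (LEAST n. B n \<ge> (real k + 1)\<^sup>2)" for k
  have monoB: "mono B"
    unfolding mono_iff_le_Suc B_def using w(1) by simp
  have D_eq: "D n \<omega> = (\<Sum>i=1..n. Y i \<omega>) - L * B n" for n \<omega>
    by (simp add: D_def B_def sum_subtractf sum_distrib_left)
  have ex: "\<exists>n. B n \<ge> x" for x
    using filterlim_at_top[THEN iffD1, OF div, rule_format, of x]
    by (auto simp: B_def eventually_sequentially)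
  have N_ge: "B (N k) \<ge> (real k + 1)\<^sup>2" for k
    unfolding N_def by (rule LeastI_ex[OF ex])
  have N: "N k \<le> n \<longleftrightarrow> B n \<ge> (real k + 1)\<^sup>2" for k n
  proof
    assume "N k \<le> n"
    then show "B n \<ge> (real k + 1)\<^sup>2" using N_ge[of k] monoD[OF monoB] by (meson order_trans)
  next
    assume "B n \<ge> (real k + 1)\<^sup>2"
    then show "N k \<le> n" unfolding N_def by (rule Least_le)
  qed
  have N_le: "B (N k) \<le> (real k + 1)\<^sup>2 + 1" for k
  proof (cases "N k")
    case 0
    then show ?thesis by (simp add: B_def)
  next
    case (Suc n)
    then have "B n < (real k + 1)\<^sup>2" using N[of k n] by simp
    then show ?thesis using w(2)[of "Suc n"] by (simp add: Suc B_def)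
  qed
  have meas [measurable]: "D n \<in> borel_measurable M" for n
    unfolding D_def using Y(1) by measurable
  have "\<bar>D n \<omega>\<bar> \<le> real n + \<bar>L * B n\<bar>" for n \<omega>
  proof -
    have "(\<Sum>i=1..n. Y i \<omega>) \<le> (\<Sum>i=1..n. 1)" using Y(3) by (intro sum_mono)
    moreover have "0 \<le> (\<Sum>i=1..n. Y i \<omega>)" using Y(2) by (intro sum_nonneg)
    ultimately show ?thesis unfolding D_eq by simp
  qed
  then have "(D n \<omega>)\<^sup>2 \<le> (real n + \<bar>L * B n\<bar>)\<^sup>2" for n \<omega>
    by (metis abs_ge_zero abs_le_square_iff abs_of_nonneg order_trans)
  then have int: "integrable M (\<lambda>\<omega>. (D n \<omega>)\<^sup>2)" for n
    by (intro integrable_const_bound[where B="(real n + \<bar>L * B n\<bar>)\<^sup>2"]) auto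
  \<comment> \<open>Only countably many tolerances \<open>1 / (q + 1)\<close> are used, so a single
    null set serves them all.\<close>
  have "AE \<omega> in M. \<forall>q::nat. \<forall>\<^sub>F k in sequentially. \<bar>D (N k) \<omega>\<bar> < B (N k) / (real q + 1)"
    unfolding AE_all_countable
  proof
    fix q :: nat
    define A where "A k = {\<omega> \<in> space M. \<bar>D (N k) \<omega>\<bar> \<ge> B (N k) / (real q + 1)}" for k
    have le: "prob (A k) \<le> \<bar>K\<bar> * (real q + 1)\<^sup>2 * (1 / (real (Suc k))\<^sup>2)" for k
    proof -
      have pos: "B (N k) > 0" using N_ge[of k] by (rule less_le_trans[rotated]) simp
      have "prob (A k) \<le> expectation (\<lambda>\<omega>. (D (N k) \<omega>)\<^sup>2) / (B (N k) / (real q + 1))\<^sup>2"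
        unfolding A_def using int pos by (intro prob_abs_ge_le_second_moment) auto
      also have "\<dots> \<le> \<bar>K\<bar> * B (N k) / (B (N k) / (real q + 1))\<^sup>2"
      proof (intro divide_right_mono)
        have "K * B (N k) \<le> \<bar>K\<bar> * B (N k)" using pos by (intro mult_right_mono) auto
        then show "expectation (\<lambda>\<omega>. (D (N k) \<omega>)\<^sup>2) \<le> \<bar>K\<bar> * B (N k)"
          using bound[of "N k"] unfolding D_def B_def by linarith
      qed auto
      also have "\<dots> = \<bar>K\<bar> * (real q + 1)\<^sup>2 * (1 / B (N k))"
        using pos by (simp add: power_divide power2_eq_square[of "B (N k)"])
      also have "\<dots> \<le> \<bar>K\<bar> * (real q + 1)\<^sup>2 * (1 / (real (Suc k))\<^sup>2)"
        using N_ge[of k] by (intro mult_left_mono frac_le) (auto simp: add.commute)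
      finally show ?thesis .
    qed
    have "summable (\<lambda>k. prob (A k))"
    proof (rule summable_comparison_test')
      have "summable (\<lambda>k. 1 / (real (Suc k))\<^sup>2)"
        using summable_Suc_iff[of "\<lambda>k. 1 / (real k)\<^sup>2"] inverse_power_summable[of 2, where 'a=real]
        by (simp add: inverse_eq_divide)
      then show "summable (\<lambda>k. \<bar>K\<bar> * (real q + 1)\<^sup>2 * (1 / (real (Suc k))\<^sup>2))"
        by (rule summable_mult)
    qed (use le in auto)
    then have "AE \<omega> in M. \<forall>\<^sub>F k in sequentially. \<omega> \<in> space M - A k"
      by (intro borel_cantelli_AE1) (auto simp: A_def emeasure_eq_measure)
    then show "AE \<omega> in M. \<forall>\<^sub>F k in sequentially. \<bar>D (N k) \<omega>\<bar> < B (N k) / (real q + 1)"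
      by eventually_elim (auto simp: A_def elim!: eventually_mono)
  qed
  then show ?thesis
  proof eventually_elim
    case (elim \<omega>)
    have lim: "(\<lambda>k. (\<Sum>i=1..N k. Y i \<omega>) / B (N k)) \<longlonglongrightarrow> L"
    proof (rule tendstoI)
      fix e :: real assume "e > 0"
      then obtain q :: nat where q: "1 / (real q + 1) < e"
        using nat_approx_posE by (metis add.commute of_nat_Suc)
      show "\<forall>\<^sub>F k in sequentially. dist ((\<Sum>i=1..N k. Y i \<omega>) / B (N k)) L < e"
        using elim[rule_format, of q]
      proof eventually_elim
        case (elim k)
        have pos: "B (N k) > 0" using N_ge[of k] by (rule less_le_trans[rotated]) simp
        have "dist ((\<Sum>i=1..N k. Y i \<omega>) / B (N k)) L = \<bar>D (N k) \<omega>\<bar> / B (N k)"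
        proof -
          have "(\<Sum>i=1..N k. Y i \<omega>) / B (N k) - L = D (N k) \<omega> / B (N k)"
            using pos by (simp add: D_eq field_simps)
          then show ?thesis using pos by (simp add: dist_real_def abs_divide)
        qed
        also have "\<dots> < 1 / (real q + 1)" using elim pos by (simp add: field_simps)
        finally show ?case using q by linarith
      qed
    qed
    have "(\<lambda>n. (\<Sum>i=1..n. Y i \<omega>) / B n) \<longlonglongrightarrow> L"
    proof (rule tendsto_along_squares[where T="\<lambda>n. \<Sum>i=1..n. Y i \<omega>", OF _ monoB _ _ N N_le lim])
      show "mono (\<lambda>n. \<Sum>i=1..n. Y i \<omega>)" unfolding mono_iff_le_Suc using Y(2) by simp
      show "0 \<le> (\<Sum>i=1..n. Y i \<omega>)" for n using Y(2) by (intro sum_nonneg)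
      show "filterlim B at_top sequentially" using div by (simp add: B_def[abs_def])
    qed
    then show ?case by (simp add: B_def)
  qed
qed

text \<open>For \<open>r \<ge> 1\<close>, \<open>\<kappa> \<le> 1\<close> and
  \<open>3 * \<kappa> \<le> A\<close>, one has
  \<open>(r + \<kappa>)\<^sup>2 \<le> r\<^sup>2 + A * r\<close>. A step of the sequence therefore
  raises its square root by at least \<open>\<kappa>\<close>, and the steps add up.\<close>

lemma growth_cond_gap:
  assumes "growth_cond A \<gamma> ns" "A > 0" "\<forall>i\<ge>1. ns i > 0"
  obtains \<kappa> where "0 < \<kappa>" "\<kappa> \<le> 1"
    "\<And>i j. 1 \<le> i \<Longrightarrow> i \<le> j \<Longrightarrow> sqrt (ns j) - sqrt (ns i) \<ge> \<kappa> * (real j - real i)"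
proof -
  define \<kappa> where "\<kappa> = min 1 (A / 3)"
  have \<kappa>: "0 < \<kappa>" "\<kappa> \<le> 1" "3 * \<kappa> \<le> A" using assms(2) by (auto simp: \<kappa>_def)
  have step: "sqrt (ns (Suc i)) - sqrt (ns i) \<ge> \<kappa>" if i: "i \<ge> 1" for i
  proof -
    define r where "r = sqrt (ns i)"
    have "1 \<le> ns i" using assms(3) i by (simp add: Suc_leI)
    then have r: "r \<ge> 1" by (simp add: r_def)
    have "\<kappa> * \<kappa> \<le> 1 * \<kappa>" "\<kappa> * 1 \<le> \<kappa> * r" "3 * \<kappa> * r \<le> A * r"
      using \<kappa> r by (intro mult_right_mono mult_left_mono; simp)+
    then have "(r + \<kappa>)\<^sup>2 \<le> r\<^sup>2 + A * r"
      by (simp add: power2_eq_square algebra_simps)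
    also have "\<dots> \<le> ns (Suc i)"
    proof -
      have "real (ns (i + 1)) - real (ns i) \<ge> A * real (ns i) powr (1/2)"
        using assms(1) i unfolding growth_cond_def by blast
      then show ?thesis by (simp add: r_def powr_half_sqrt)
    qed
    finally have "r + \<kappa> \<le> sqrt (ns (Suc i))" by (rule real_le_rsqrt)
    then show ?thesis by (simp add: r_def)
  qed
  have "sqrt (ns j) - sqrt (ns i) \<ge> \<kappa> * (real j - real i)" if "1 \<le> i" "i \<le> j" for i j
    using that(2)
  proof (induction j rule: dec_induct)
    case (step n)
    then show ?case using \<open>1 \<le> i\<close> assms \<open>\<And>i. i \<ge> 1 \<Longrightarrow> sqrt (ns (Suc i)) - sqrt (ns i) \<ge> \<kappa>\<close>[of n]
      by (simp add: algebra_simps)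
  qed simp
  with \<kappa>(1,2) show ?thesis by (rule that)
qed

section \<open>Growth rate of the normalising sum\<close>

lemma sum_inverse_ge_ln:
  assumes "1 \<le> k" "k \<le> n"
  shows "ln (real n) - ln (real k) \<le> (\<Sum>i=k..n. 1 / real i)"
proof -
  have "ln (real n) - ln (real k) \<le> ln (real (Suc n)) - ln (real k)"
    using assms by simp
  also have "\<dots> = (\<Sum>i=k..n. ln (real (Suc i)) - ln (real i))"
    using assms by (subst sum_Suc_diff) auto
  also have "\<dots> \<le> (\<Sum>i=k..n. 1 / real i)"
  proof (intro sum_mono)
    fix i assume "i \<in> {k..n}"
    then have i: "real i > 0" using assms by auto
    have "ln (real (Suc i)) - ln (real i) = ln (real (Suc i) / real i)"
      using i by (simp add: ln_div del: of_nat_Suc)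
    also have "real (Suc i) / real i = 1 + 1 / real i"
      using i by (simp add: field_simps)
    also have "ln (1 + 1 / real i) \<le> 1 / real i" using i by (intro ln_add_one_self_le_self) simp
    finally show "ln (real (Suc i)) - ln (real i) \<le> 1 / real i" .
  qed
  finally show ?thesis .
qed

text \<open>Where the triple logarithm is at least 1, the factors with negative exponents are at
  most 1. This leaves \<open>sqrt (ns i) \<le> i * sqrt (ln n / A)\<close> for
  \<open>i \<le> n\<close>, and the harmonic sum produces the logarithm.\<close>

lemma growth_cond_sum_ge:
  assumes "growth_cond A \<gamma> ns" "A > 0" "\<gamma> > 1" "\<forall>i\<ge>1. ns i > 0"
  obtains k where "k \<ge> 1"
    "\<And>n. k \<le> n \<Longrightarrow> sqrt A * (ln (real n) - ln (real k)) / sqrt (ln (real n)) \<le> (\<Sum>i=1..n. 1 / sqrt (ns i))"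
proof -
  have "\<forall>\<^sub>F i in sequentially. ln (ln (ln (real i))) \<ge> 1" by real_asymp
  then obtain k where k: "\<And>i. i \<ge> k \<Longrightarrow> ln (ln (ln (real i))) \<ge> 1"
    by (auto simp: eventually_sequentially)
  define k' where "k' = max 1 k"
  have "sqrt A * (ln (real n) - ln (real k')) / sqrt (ln (real n)) \<le> (\<Sum>i=1..n. 1 / sqrt (ns i))"
    if n: "k' \<le> n" for n
  proof -
    \<comment> \<open>As \<open>ln\<close> is total, the lower logarithms are bounded through
      \<open>logloglog_pos_iff\<close> instead of by reading the inequality backwards.\<close>
    have large: "ln (real i) > 1" "ln (ln (real i)) > 1" if "i \<ge> k" for i
    proof -
      have "real i > exp (exp 1)"
        using k[OF that] by (subst logloglog_pos_iff[symmetric]) linarith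
      then show "ln (ln (real i)) > 1"
        by (metis exp_gt_zero ln_exp ln_less_cancel_iff order_less_trans)
      have "exp 1 < ln (real i)"
        using \<open>real i > exp (exp 1)\<close> by (metis exp_gt_zero ln_exp ln_less_cancel_iff order_less_trans)
      then show "ln (real i) > 1"
        using exp_ge_add_one_self[of "1::real"] by linarith
    qed
    have term_ge: "sqrt A / sqrt (ln (real n)) * (1 / real i) \<le> 1 / sqrt (ns i)" if i: "i \<in> {k'..n}" for i
    proof -
      have i1: "i \<ge> 1" "i \<ge> k" "i \<le> n" using i by (auto simp: k'_def)
      define P where "P = ln (ln (real i)) powr (-3) * ln (ln (ln (real i))) powr (-2 * \<gamma>)"
      have "ln (ln (real i)) powr (-3) \<le> ln (ln (real i)) powr 0"
        "ln (ln (ln (real i))) powr (-2 * \<gamma>) \<le> ln (ln (ln (real i))) powr 0"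
        using large(2)[OF i1(2)] k[OF i1(2)] assms(3) by (intro powr_mono; simp)+
      then have "P \<le> 1 * 1"
        unfolding P_def using large(2)[OF i1(2)] k[OF i1(2)] by (intro mult_mono) auto
      have "real (ns i) \<le> inverse A * (real i)\<^sup>2 * ln (real i) * ln (ln (real i)) powr (-3)
                       * ln (ln (ln (real i))) powr (-2 * \<gamma>)"
        using assms(1) i1 k[OF i1(2)] unfolding growth_cond_def by (meson less_le_trans zero_less_one)
      also have "\<dots> = inverse A * (real i)\<^sup>2 * ln (real i) * P" by (simp add: P_def)
      also have "\<dots> \<le> inverse A * (real i)\<^sup>2 * ln (real n) * 1"
        using \<open>P \<le> 1 * 1\<close> large[OF i1(2)] assms(2) i1 by (intro mult_mono) (auto simp: P_def)
      finally have "sqrt (ns i) \<le> sqrt ((real i)\<^sup>2 * (ln (real n) / A))"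
        by (simp add: divide_inverse mult_ac)
      also have "\<dots> = real i * (sqrt (ln (real n)) / sqrt A)"
        by (simp add: real_sqrt_mult real_sqrt_divide)
      finally have "1 / (real i * (sqrt (ln (real n)) / sqrt A)) \<le> 1 / sqrt (ns i)"
        using assms(4) i1 by (intro frac_le) auto
      then show ?thesis by (simp add: mult_ac)
    qed
    have "sqrt A / sqrt (ln (real n)) * (ln (real n) - ln (real k')) \<le>
        sqrt A / sqrt (ln (real n)) * (\<Sum>i=k'..n. 1 / real i)"
      using n assms(2) large(1)[of n]
      by (intro mult_left_mono sum_inverse_ge_ln) (auto simp: k'_def)
    also have "\<dots> \<le> (\<Sum>i=k'..n. 1 / sqrt (ns i))"
      unfolding sum_distrib_left by (intro sum_mono term_ge)
    also have "\<dots> \<le> (\<Sum>i=1..n. 1 / sqrt (ns i))"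
      by (intro sum_mono2) (auto simp: k'_def)
    finally show ?thesis by simp
  qed
  moreover have "k' \<ge> 1" by (simp add: k'_def)
  ultimately show ?thesis using that by blast
qed

lemma growth_cond_sum_at_top:
  assumes "growth_cond A \<gamma> ns" "A > 0" "\<gamma> > 1" "\<forall>i\<ge>1. ns i > 0"
  shows "filterlim (\<lambda>n. \<Sum>i=1..n. 1 / sqrt (ns i)) at_top sequentially"
proof -
  obtain k where k: "k \<ge> 1"
    "\<And>n. k \<le> n \<Longrightarrow> sqrt A * (ln (real n) - ln (real k)) / sqrt (ln (real n)) \<le> (\<Sum>i=1..n. 1 / sqrt (ns i))"
    using growth_cond_sum_ge[OF assms] by blast
  define a c where "a = sqrt A" and "c = ln (real k)"
  have "a > 0" using assms(2) by (simp add: a_def)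
  then have "filterlim (\<lambda>n. a * (ln (real n) - c) / sqrt (ln (real n))) at_top sequentially"
    by real_asymp
  then show ?thesis
    by (rule filterlim_at_top_mono)
      (use k(2) in \<open>auto simp: a_def c_def eventually_sequentially\<close>)
qed

text \<open>The sum grows at least like \<open>sqrt (ln n)\<close>, which eventually dominates the
  left-hand side. The finitely many remaining \<open>n\<close> are absorbed into \<open>C\<close>,
  because the first summand alone bounds the sum from below.\<close>

lemma growth_cond_sum_lower_bound:
  assumes "growth_cond A \<gamma> ns" "A > 0" "\<gamma> > 1" "\<forall>i\<ge>1. ns i > 0"
  obtains C where "C > 0"
    "\<And>n. n \<ge> 1 \<Longrightarrow> ln (ln (real n)) * ln (ln (ln (real n))) powr \<gamma> \<le> C * (\<Sum>i=1..n. 1 / sqrt (ns i))"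
proof -
  obtain k where k: "k \<ge> 1"
    "\<And>n. k \<le> n \<Longrightarrow> sqrt A * (ln (real n) - ln (real k)) / sqrt (ln (real n)) \<le> (\<Sum>i=1..n. 1 / sqrt (ns i))"
    using growth_cond_sum_ge[OF assms] by blast
  define a c where "a = sqrt A" and "c = ln (real k)"
  define f where "f n = ln (ln (real n)) * ln (ln (ln (real n))) powr \<gamma>" for n :: nat
  define B where "B n = (\<Sum>i=1..n. 1 / sqrt (ns i))" for n
  have "a > 0" "\<gamma> > 0" using assms by (auto simp: a_def)
  then have "\<forall>\<^sub>F n in sequentially. f n \<le> a * (ln (real n) - c) / sqrt (ln (real n))"
    unfolding f_def by real_asymp
  then obtain m where m: "\<And>n. n \<ge> m \<Longrightarrow> f n \<le> a * (ln (real n) - c) / sqrt (ln (real n))"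
    by (auto simp: eventually_sequentially)
  define V where "V = (\<Sum>n<max m k. \<bar>f n\<bar>)"
  \<comment> \<open>\<open>V\<close> bounds the left-hand side at the exceptional \<open>n\<close>,
    and \<open>sqrt (ns 1)\<close> compensates for the first summand; the 1 covers the large
    \<open>n\<close>.\<close>
  define C where "C = 1 + V * sqrt (ns 1)"
  have V: "V \<ge> 0" unfolding V_def by (intro sum_nonneg) auto
  have "f n \<le> C * B n" if n: "n \<ge> 1" for n
  proof (cases "n \<ge> max m k")
    case True
    then have "f n \<le> B n" using m[of n] k(2)[of n] by (simp add: a_def c_def B_def)
    also have "B n \<le> C * B n"
      using mult_right_mono[of 1 C "B n"] V by (simp add: C_def B_def sum_nonneg)
    finally show ?thesis .
  next
    case False
    have "1 / sqrt (ns 1) \<le> B n"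
      unfolding B_def using n by (intro member_le_sum[where f="\<lambda>i. 1 / sqrt (ns i)"]) auto
    then have "1 \<le> sqrt (ns 1) * B n"
      using assms(4) by (simp add: field_simps)
    moreover have "f n \<le> V"
    proof -
      have "n \<in> {..<max m k}" using False by (auto simp: less_max_iff_disj)
      then have "\<bar>f n\<bar> \<le> V"
        unfolding V_def by (intro member_le_sum[where f="\<lambda>n. \<bar>f n\<bar>"]) auto
      then show ?thesis by simp
    qed
    ultimately have "f n \<le> V * (sqrt (ns 1) * B n)"
      using V mult_left_mono[of 1 "sqrt (ns 1) * B n" V] by simp
    also have "\<dots> \<le> C * B n" by (simp add: C_def B_def algebra_simps sum_nonneg)
    finally show ?thesis .
  qed
  moreover have "C > 0" using V by (simp add: C_def add_pos_nonneg)
  ultimately show ?thesis using that unfolding f_def B_def by blast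
qed

section \<open>Conclusion\<close>

lemma powr_minus_half: "x \<ge> 0 \<Longrightarrow> x powr (-1/2) = 1 / sqrt x"
  using powr_minus_divide[of x "1/2"] by (simp add: powr_half_sqrt)

context lattice_walk
begin

text \<open>Since \<open>1 / n \<le> 1 / sqrt n\<close>, hit probabilities are of order
  \<open>n\<close> to the power \<open>-1/2\<close>, and Borel-Cantelli applies. The local limit
  theorem is stated for multiples of \<open>\<sigma>\<close>, hence the parameter
  \<open>a / \<sigma>\<close>.\<close>

lemma prob_infinitely_many_hits_eq_0:
  fixes ns :: "nat \<Rightarrow> nat"
  assumes ns: "\<forall>i\<ge>1. ns i > 0" and sum: "summable (\<lambda>i. real (ns (Suc i)) powr (-1/2))"
  shows "prob {\<omega> \<in> space M. infinite {i. i \<ge> 1 \<and> \<omega> \<in> hit_event M X h b a (ns i)}} = 0"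
proof -
  obtain K where K: "K > 0"
    "\<And>a n. n \<ge> 1 \<Longrightarrow> \<bar>prob (hit_event M X h b (a * \<sigma>) n) - limit_density h \<sigma> a / sqrt n\<bar> \<le> K / n"
    by (rule prob_hit_event_approx) (rule that)
  define H where "H i = hit_event M X h b a (ns i)" for i
  let ?D = "limit_density h \<sigma> (a / \<sigma>)"
  have "prob (H (Suc i)) \<le> (K + ?D) * real (ns (Suc i)) powr (-1/2)" for i
  proof -
    have n: "1 \<le> ns (Suc i)" using ns by (simp add: Suc_leI)
    then have "1 \<le> sqrt (ns (Suc i))" by simp
    then have "sqrt (ns (Suc i)) \<le> ns (Suc i)"
      using mult_left_mono[of 1 "sqrt (ns (Suc i))" "sqrt (ns (Suc i))"] by simp
    then have "K / ns (Suc i) \<le> K / sqrt (ns (Suc i))"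
      using n K(1) by (intro divide_left_mono) auto
    moreover have "prob (H (Suc i)) - ?D / sqrt (ns (Suc i)) \<le> K / ns (Suc i)"
      using K(2)[OF n, of "a / \<sigma>"] \<sigma> by (simp add: H_def)
    moreover have "(K + ?D) * real (ns (Suc i)) powr (-1/2) = K / sqrt (ns (Suc i)) + ?D / sqrt (ns (Suc i))"
      by (simp only: powr_minus_half of_nat_0_le_iff) (simp add: add_divide_distrib)
    ultimately show ?thesis by linarith
  qed
  then have "norm (prob (H (Suc i))) \<le> (K + ?D) * real (ns (Suc i)) powr (-1/2)" for i
    by (simp only: real_norm_def abs_of_nonneg measure_nonneg)
  then have "summable (\<lambda>i. prob (H (Suc i)))"
    by (rule summable_comparison_test'[OF summable_mult[OF sum]])
  then have "AE \<omega> in M. \<forall>\<^sub>F i in sequentially. \<omega> \<in> space M - H (Suc i)"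
    by (intro borel_cantelli_AE1) (auto simp: H_def emeasure_eq_measure)
  then have AE: "AE \<omega> in M. \<not> infinite {i. i \<ge> 1 \<and> \<omega> \<in> H i}"
  proof eventually_elim
    case (elim \<omega>)
    then obtain k where k: "\<And>i. i \<ge> k \<Longrightarrow> \<omega> \<notin> H (Suc i)"
      by (auto simp: eventually_sequentially)
    have "{i. i \<ge> 1 \<and> \<omega> \<in> H i} \<subseteq> {..k}"
    proof
      fix i assume i: "i \<in> {i. i \<ge> 1 \<and> \<omega> \<in> H i}"
      then obtain l where l: "i = Suc l" by (cases i) auto
      have "\<not> k \<le> l" using k[of l] i l by auto
      then show "i \<in> {..k}" using l by simp
    qed
    then show ?case by (simp add: finite_subset)
  qed
  let ?E = "{\<omega> \<in> space M. infinite {i. i \<ge> 1 \<and> \<omega> \<in> H i}}"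
  show ?thesis
  \<comment> \<open>A non-measurable set has measure 0 by convention, so the claim holds in either
    case.\<close>
  proof (cases "?E \<in> sets M")
    case True
    have "AE \<omega> in M. \<omega> \<notin> ?E" using AE by eventually_elim auto
    then show ?thesis using prob_eq_0[OF True] by (simp add: H_def)
  next
    case False
    then show ?thesis unfolding H_def by (rule measure_notin_sets)
  qed
qed

lemma hit_ratio_eq:
  "hit_ratio M X h b ns c n \<omega> =
    (\<Sum>i=1..n. indicator (hit_event M X h b c (ns i)) \<omega>) / (\<Sum>i=1..n. 1 / sqrt (real (ns i)))"
  by (simp only: hit_ratio_def powr_minus_half of_nat_0_le_iff)

text \<open>The general law is applied with weights \<open>1 / sqrt (ns i)\<close>, which are at
  most 1 and have a divergent sum. The uniform second moment bound is used on the range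
  \<open>\<bar>a\<bar> + 1\<close>, which is positive even for \<open>a = 0\<close>.\<close>

lemma AE_hit_ratio_tendsto:
  assumes ns: "\<forall>i\<ge>1. ns i > 0" and growth: "growth_cond A \<gamma> ns" "A > 0" "\<gamma> > 1"
  shows "AE \<omega> in M. (\<lambda>m. hit_ratio M X h b ns (a * \<sigma>) m \<omega>) \<longlonglongrightarrow> limit_density h \<sigma> a"
proof -
  obtain \<kappa> where \<kappa>: "0 < \<kappa>" "\<kappa> \<le> 1"
    "\<And>i j. 1 \<le> i \<Longrightarrow> i \<le> j \<Longrightarrow> sqrt (ns j) - sqrt (ns i) \<ge> \<kappa> * (real j - real i)"
    by (rule growth_cond_gap[OF growth(1,2) ns]) (rule that)
  have ns1: "ns i \<ge> 1" if "i \<ge> 1" for i using ns that by (simp add: Suc_leI)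
  have N: "\<bar>a\<bar> + 1 > 0" by simp
  obtain K where K: "K > 0"
    "\<And>\<alpha> n. \<bar>\<alpha>\<bar> \<le> \<bar>a\<bar> + 1 \<Longrightarrow> expectation (\<lambda>\<omega>. (\<Sum>i=1..n. indicator (hit_event M X h b (\<alpha> * \<sigma>) (ns i)) \<omega>
        - limit_density h \<sigma> \<alpha> / sqrt (ns i))\<^sup>2) \<le> K * (\<Sum>i=1..n. 1 / sqrt (ns i))"
    by (rule second_moment_hit_count_le[OF N \<kappa>(1,2) \<kappa>(3) ns1[OF order_refl]]) (assumption+, rule that)
  show ?thesis
    unfolding hit_ratio_eq
  proof (rule AE_ratio_tendsto[where K=K])
    show "filterlim (\<lambda>n. \<Sum>i=1..n. 1 / sqrt (real (ns i))) at_top sequentially"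
      using growth ns by (rule growth_cond_sum_at_top)
    show "1 / sqrt (real (ns i)) \<le> 1" if "i \<ge> 1" for i
      using ns1[OF that] by simp
    show "expectation (\<lambda>\<omega>. (\<Sum>i=1..n. indicat_real (hit_event M X h b (a * \<sigma>) (ns i)) \<omega> -
        limit_density h \<sigma> a * (1 / sqrt (real (ns i))))\<^sup>2) \<le> K * (\<Sum>i=1..n. 1 / sqrt (real (ns i)))" for n
      using K(2)[of a n] by simp
  qed auto
qed

text \<open>In terms of the centred count \<open>D\<close>, a deviation by \<open>\<epsilon>\<close>
  forces \<open>\<bar>D \<omega>\<bar> \<ge> \<epsilon> * (L * B)\<close>. Chebyshev then leaves
  \<open>K / (\<epsilon>\<^sup>2 * L\<^sup>2 * B)\<close>, and the lower bound for \<open>B\<close>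
  gives the stated rate.\<close>

lemma prob_deviation_le:
  assumes ns: "\<forall>i\<ge>1. ns i > 0" and growth: "growth_cond A \<gamma> ns" "A > 0" "\<gamma> > 1" and N: "N > 0"
  obtains C where "C > 0"
    "\<And>\<alpha> \<epsilon> m. \<bar>\<alpha>\<bar> \<le> N \<Longrightarrow> \<epsilon> > 0 \<Longrightarrow> ln (ln (ln (real m))) > 0 \<Longrightarrow>
      prob {\<omega> \<in> space M. \<bar>\<Delta> M X h b \<sigma> ns \<alpha> m \<omega> - 1\<bar> > \<epsilon>} \<le>
        C * \<epsilon> powr (-2) * ln (ln (real m)) powr (-1) * ln (ln (ln (real m))) powr (-\<gamma>)"
proof -
  obtain \<kappa> where \<kappa>: "0 < \<kappa>" "\<kappa> \<le> 1"
    "\<And>i j. 1 \<le> i \<Longrightarrow> i \<le> j \<Longrightarrow> sqrt (ns j) - sqrt (ns i) \<ge> \<kappa> * (real j - real i)"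
    by (rule growth_cond_gap[OF growth(1,2) ns]) (rule that)
  have ns1: "ns 1 \<ge> 1" using ns by (simp add: Suc_leI)
  obtain K where K: "K > 0"
    "\<And>\<alpha> n. \<bar>\<alpha>\<bar> \<le> N \<Longrightarrow> expectation (\<lambda>\<omega>. (\<Sum>i=1..n. indicator (hit_event M X h b (\<alpha> * \<sigma>) (ns i)) \<omega>
        - limit_density h \<sigma> \<alpha> / sqrt (ns i))\<^sup>2) \<le> K * (\<Sum>i=1..n. 1 / sqrt (ns i))"
    by (rule second_moment_hit_count_le[OF N \<kappa>(1,2) \<kappa>(3) ns1]) (assumption+, rule that)
  obtain C0 where C0: "C0 > 0"
    "\<And>n. n \<ge> 1 \<Longrightarrow> ln (ln (real n)) * ln (ln (ln (real n))) powr \<gamma> \<le> C0 * (\<Sum>i=1..n. 1 / sqrt (ns i))"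
    by (rule growth_cond_sum_lower_bound[OF growth ns]) (rule that)
  \<comment> \<open>The density decreases in \<open>\<bar>\<alpha>\<bar>\<close>, so its value at
    \<open>N\<close> is a lower bound on the whole range; this makes \<open>C\<close> uniform in
    \<open>\<alpha>\<close>.\<close>
  define L0 where "L0 = limit_density h \<sigma> N"
  have L0: "L0 > 0" using h \<sigma> by (simp add: L0_def limit_density_def)
  define C where "C = K * C0 / L0\<^sup>2"
  have "C > 0" using K C0 L0 by (simp add: C_def)
  moreover have "prob {\<omega> \<in> space M. \<bar>\<Delta> M X h b \<sigma> ns \<alpha> m \<omega> - 1\<bar> > \<epsilon>} \<le>
        C * \<epsilon> powr (-2) * ln (ln (real m)) powr (-1) * ln (ln (ln (real m))) powr (-\<gamma>)"
    if \<alpha>: "\<bar>\<alpha>\<bar> \<le> N" and \<epsilon>: "\<epsilon> > 0" and m: "ln (ln (ln (real m))) > 0" for \<alpha> \<epsilon> m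
  proof -
    define L where "L = limit_density h \<sigma> \<alpha>"
    define B where "B = (\<Sum>i=1..m. 1 / sqrt (real (ns i)))"
    define D where "D \<omega> = (\<Sum>i=1..m. indicator (hit_event M X h b (\<alpha> * \<sigma>) (ns i)) \<omega> - L / sqrt (real (ns i)))" for \<omega>
    have m_gt: "real m > exp (exp 1)" using m by (simp only: logloglog_pos_iff)
    then have m1: "m \<ge> 1" using exp_gt_zero[of "exp 1 :: real"] by (cases m) auto
    have lnm: "ln (real m) > exp 1"
      using m_gt by (metis exp_gt_zero ln_exp ln_less_cancel_iff order_less_trans)
    then have lnlnm: "ln (ln (real m)) > 1"
      by (metis exp_gt_zero ln_exp ln_less_cancel_iff order_less_trans)
    have "L0 \<le> L"
    proof -
      have "\<alpha>\<^sup>2 \<le> N\<^sup>2" using power_mono[OF \<alpha>, of 2] by simp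
      then show ?thesis
        unfolding L0_def L_def limit_density_def using h \<sigma> by (intro mult_left_mono) auto
    qed
    then have L: "L > 0" using L0 by linarith
    have B: "B > 0"
      unfolding B_def using m1 ns by (intro sum_pos) auto
    have D_meas: "D \<in> borel_measurable M" unfolding D_def by measurable
    have int: "integrable M (\<lambda>\<omega>. (D \<omega>)\<^sup>2)"
      unfolding D_def power2_eq_square sum_product left_diff_distrib right_diff_distrib
      by (auto simp flip: indicator_inter_arith)
    have "prob {\<omega> \<in> space M. \<bar>\<Delta> M X h b \<sigma> ns \<alpha> m \<omega> - 1\<bar> > \<epsilon>} \<le> prob {\<omega> \<in> space M. \<bar>D \<omega>\<bar> \<ge> \<epsilon> * (L * B)}"
    proof (rule finite_measure_mono)
      show "{\<omega> \<in> space M. \<bar>\<Delta> M X h b \<sigma> ns \<alpha> m \<omega> - 1\<bar> > \<epsilon>} \<subseteq> {\<omega> \<in> space M. \<bar>D \<omega>\<bar> \<ge> \<epsilon> * (L * B)}"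
      proof safe
        fix \<omega> assume "\<bar>\<Delta> M X h b \<sigma> ns \<alpha> m \<omega> - 1\<bar> > \<epsilon>"
        moreover have "D \<omega> = (\<Sum>i=1..m. indicator (hit_event M X h b (\<alpha> * \<sigma>) (ns i)) \<omega>) - L * B"
          by (simp add: D_def B_def sum_subtractf sum_distrib_left)
        then have "\<Delta> M X h b \<sigma> ns \<alpha> m \<omega> - 1 = D \<omega> / (L * B)"
          using L B unfolding \<Delta>_def hit_ratio_eq B_def[symmetric] L_def[symmetric] by (simp add: field_simps)
        ultimately have "\<epsilon> < \<bar>D \<omega>\<bar> / (L * B)"
          using L B by (simp add: abs_divide)
        then show "\<epsilon> * (L * B) \<le> \<bar>D \<omega>\<bar>"
          using L B by (simp add: pos_less_divide_eq)
      qed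
      show "{\<omega> \<in> space M. \<bar>D \<omega>\<bar> \<ge> \<epsilon> * (L * B)} \<in> events" using D_meas by measurable
    qed
    also have "\<dots> \<le> expectation (\<lambda>\<omega>. (D \<omega>)\<^sup>2) / (\<epsilon> * (L * B))\<^sup>2"
      using int D_meas L B \<epsilon> by (intro prob_abs_ge_le_second_moment) auto
    also have "\<dots> \<le> K * B / (\<epsilon> * (L * B))\<^sup>2"
      using K(2)[OF \<alpha>, of m] by (intro divide_right_mono) (auto simp: D_def B_def L_def)
    also have "\<dots> = K / (\<epsilon>\<^sup>2 * L\<^sup>2 * B)"
      using B by (simp add: power_mult_distrib power2_eq_square[of B])
    also have "\<dots> \<le> K / (\<epsilon>\<^sup>2 * L0\<^sup>2 * (ln (ln (real m)) * ln (ln (ln (real m))) powr \<gamma> / C0))"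
    proof (intro frac_le mult_mono power_mono mult_pos_pos divide_pos_pos)
      show "ln (ln (real m)) * ln (ln (ln (real m))) powr \<gamma> / C0 \<le> B"
        using C0(2)[OF m1] C0(1) by (simp add: B_def pos_divide_le_eq mult.commute)
    qed (use K C0 L0 \<open>L0 \<le> L\<close> \<epsilon> lnlnm m in auto)
    also have "\<dots> = C * (1 / \<epsilon>\<^sup>2) * (1 / ln (ln (real m))) * (1 / ln (ln (ln (real m))) powr \<gamma>)"
      by (simp add: C_def mult_ac)
    also have "1 / \<epsilon>\<^sup>2 = \<epsilon> powr (-2)"
      using \<epsilon> by (simp add: powr_minus_divide)
    also have "1 / ln (ln (real m)) = ln (ln (real m)) powr (-1)"
      using lnlnm by (simp add: powr_minus_divide)
    also have "1 / ln (ln (ln (real m))) powr \<gamma> = ln (ln (ln (real m))) powr (-\<gamma>)"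
      by (simp add: powr_minus_divide)
    finally show ?thesis .
  qed
  ultimately show ?thesis by (rule that)
qed

end

theorem theorem2:
  fixes M :: "'a measure" and X :: "nat \<Rightarrow> 'a \<Rightarrow> real"
    and h b \<sigma> a :: real and ns :: "nat \<Rightarrow> nat"
  assumes "prob_space M"
    and "iid M X"
    and "\<forall>i\<ge>1. lattice_valued M (X i) h b"
    and "\<forall>i\<ge>1. integrable M (\<lambda>\<omega>. \<bar>X i \<omega>\<bar> ^ 3)"
    and "\<forall>i\<ge>1. prob_space.expectation M (X i) = 0"
    and "\<forall>i\<ge>1. prob_space.expectation M (\<lambda>\<omega>. (X i \<omega>)\<^sup>2) = \<sigma>\<^sup>2"
    and "\<sigma> > 0"
    and "mono_on {1..} ns"
    and "\<forall>i\<ge>1. ns i > 0"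
  shows
    "(summable (\<lambda>i. real (ns (Suc i)) powr (-1/2)) \<longrightarrow>
        measure M {\<omega> \<in> space M. infinite {i. i \<ge> 1 \<and> \<omega> \<in> hit_event M X h b a (ns i)}} = 0)
     \<and>
     ((\<exists>A>0. \<exists>\<gamma>>1. growth_cond A \<gamma> ns) \<longrightarrow>
        (AE \<omega> in M. (\<lambda>m. hit_ratio M X h b ns (a * \<sigma>) m \<omega>) \<longlonglongrightarrow> limit_density h \<sigma> a))
     \<and>
     (\<forall>A>0. \<forall>\<gamma>>1. growth_cond A \<gamma> ns \<longrightarrow>
        (\<forall>N>0. \<exists>C>0. \<forall>\<epsilon>>0. \<forall>m::nat. ln (ln (ln (real m))) > 0 \<longrightarrow>
           (SUP \<alpha>\<in>{-N..N}. measure M {\<omega> \<in> space M. \<bar>\<Delta> M X h b \<sigma> ns \<alpha> m \<omega> - 1\<bar> > \<epsilon>})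
             \<le> C * \<epsilon> powr (-2) * ln (ln (real m)) powr (-1) * ln (ln (ln (real m))) powr (-\<gamma>)))"
proof -
  interpret lattice_walk M X h b \<sigma>
    using assms by (auto simp: lattice_walk_def lattice_walk_axioms_def)
  note ns = assms(9)
  show ?thesis
  proof (intro conjI impI allI)
    assume "summable (\<lambda>i. real (ns (Suc i)) powr (-1/2))"
    then show "prob {\<omega> \<in> space M. infinite {i. i \<ge> 1 \<and> \<omega> \<in> hit_event M X h b a (ns i)}} = 0"
      by (rule prob_infinitely_many_hits_eq_0[OF ns])
  next
    assume "\<exists>A>0. \<exists>\<gamma>>1. growth_cond A \<gamma> ns"
    then show "AE \<omega> in M. (\<lambda>m. hit_ratio M X h b ns (a * \<sigma>) m \<omega>) \<longlonglongrightarrow> limit_density h \<sigma> a"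
      using AE_hit_ratio_tendsto[OF ns] by blast
  next
    fix A \<gamma> N :: real
    assume *: "A > 0" "\<gamma> > 1" "growth_cond A \<gamma> ns" "N > 0"
    obtain C where C: "C > 0"
      "\<And>\<alpha> \<epsilon> m. \<bar>\<alpha>\<bar> \<le> N \<Longrightarrow> \<epsilon> > 0 \<Longrightarrow> ln (ln (ln (real m))) > 0 \<Longrightarrow>
        prob {\<omega> \<in> space M. \<bar>\<Delta> M X h b \<sigma> ns \<alpha> m \<omega> - 1\<bar> > \<epsilon>} \<le>
          C * \<epsilon> powr (-2) * ln (ln (real m)) powr (-1) * ln (ln (ln (real m))) powr (-\<gamma>)"
      by (rule prob_deviation_le[OF ns *(3,1,2,4)]) (rule that)
    \<comment> \<open>The constant is uniform over the interval, which is nonempty as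
      \<open>N > 0\<close>, so the pointwise bound passes to the supremum.\<close>
    show "\<exists>C>0. \<forall>\<epsilon>>0. \<forall>m::nat. ln (ln (ln (real m))) > 0 \<longrightarrow>
           (SUP \<alpha>\<in>{-N..N}. prob {\<omega> \<in> space M. \<bar>\<Delta> M X h b \<sigma> ns \<alpha> m \<omega> - 1\<bar> > \<epsilon>})
             \<le> C * \<epsilon> powr (-2) * ln (ln (real m)) powr (-1) * ln (ln (ln (real m))) powr (-\<gamma>)"
      using \<open>N > 0\<close> by (intro exI[of _ C] conjI C(1) allI impI cSUP_least C(2)) auto
  qed
qed

end
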